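(* Let $F:\mathbb{R}_+\to\mathbb{R}$ be measurable, positive and locally bounded. Let $\alpha>-1$ and $A\in\mathscr{A}^\infty_0$. Write $\hat F(1/\cdot)$ for the function $\lambda\mapsto\hat F(1/\lambda)$, $\lambda>0$. The following hold. (1) If $F\in\mathrm{2RV}^\infty_{\alpha,0}(A)$, then $\hat F(1/\cdot)\in\mathrm{2RV}^\infty_{\alpha,0}(A)$. (2) If $\hat F(1/\cdot)\in\mathrm{2RV}^\infty_{\alpha,0}(A)$ and $F\in\mathscr{M}^\infty_{\alpha,0}$, then $F\in\mathrm{2RV}^\infty_{\alpha,0}(A)$.
   Context: A measurable function $F$ (defined on $\mathbb{R}_+$ or $(0,\infty)$) is regularly varying at infinity with index $\alpha\in\mathbb{R}$, written $F\in\mathrm{RV}^\infty_\alpha$, if it has constant sign near infinity and $\lim_{t\to\infty}F(tx)/F(t)=x^\alpha$ for every $x>0$. A function $F\in\mathrm{RV}^\infty_\alpha$ belongs to $\mathrm{2RV}^\infty_{\alpha,0}(A)$ (where $A$ is an eventually positive or eventually negative function) if for every $x>0$ $$\lim_{t\to\infty}\frac{F(tx)/F(t)-x^\alpha}{A(t)}=x^\alpha\log x .$$ $\mathscr{A}^\infty_0:=\{A\in\mathrm{RV}^\infty_0:\lim_{t\to\infty}A(t)=0\}$. The Laplace–Stieltjes transform of a locally integrable $F$ is $\hat F(\lambda):=\int_0^\infty\lambda e^{-\lambda t}F(t)\,dt$, $\lambda>0$. For $\kappa\in\mathbb{R}$, $\mathscr{M}^\infty_{\kappa,0}$ is the set of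 functions $F:\mathbb{R}_+\to\mathbb{R}$ that are locally bounded, eventually positive or eventually negative, and such that $t^{-\kappa}F(t)$ is eventually monotone. *)

theory Defs
  imports "HOL-Analysis.Analysis"
begin

text \<open>
  Functions on \<open>[0,\<infinity>)\<close> or \<open>(0,\<infinity>)\<close> are total functions on the reals; their values outside
  the domain play no role. Measurability is Lebesgue measurability.
\<close>

definition eventually_const_sign :: "(real \<Rightarrow> real) \<Rightarrow> bool" where
  "eventually_const_sign F \<longleftrightarrow>
     (\<forall>\<^sub>F t in at_top. F t > 0) \<or> (\<forall>\<^sub>F t in at_top. F t < 0)"

definition RV_inf :: "real \<Rightarrow> (real \<Rightarrow> real) set" where
  "RV_inf \<alpha> = {F. F \<in> borel_measurable (lebesgue_on {0<..}) \<and>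
     eventually_const_sign F \<and>
     (\<forall>x>0. ((\<lambda>t. F (t * x) / F t) \<longlongrightarrow> x powr \<alpha>) at_top)}"

text \<open>Second-order regular variation with second-order index \<open>0\<close> and auxiliary function \<open>A\<close>.\<close>

definition twoRV_inf_0 :: "real \<Rightarrow> (real \<Rightarrow> real) \<Rightarrow> (real \<Rightarrow> real) set" where
  "twoRV_inf_0 \<alpha> A = {F. F \<in> RV_inf \<alpha> \<and> eventually_const_sign A \<and>
     (\<forall>x>0. ((\<lambda>t. (F (t * x) / F t - x powr \<alpha>) / A t) \<longlongrightarrow> x powr \<alpha> * ln x) at_top)}"

definition A_inf_0 :: "(real \<Rightarrow> real) set" where
  "A_inf_0 = {A. A \<in> RV_inf 0 \<and> (A \<longlongrightarrow> 0) at_top}"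

text \<open>
  The Bochner integral is \<open>0\<close> where the integrand is not integrable. For positive, locally bounded
  \<open>F\<close>, divergence at one \<open>s\<close> implies divergence at all smaller positive \<open>s\<close>, so the constant sign
  condition in \<^const>\<open>RV_inf\<close>, applied to \<open>s \<mapsto> LS_transform F (1 / s)\<close>, forces the integral
  to converge for every \<open>s > 0\<close>.
\<close>

definition LS_transform :: "(real \<Rightarrow> real) \<Rightarrow> real \<Rightarrow> real" where
  "LS_transform F s = (LINT t:{0..}|lebesgue. s * exp (- s * t) * F t)"

definition locally_bounded_on :: "real set \<Rightarrow> (real \<Rightarrow> real) \<Rightarrow> bool" where
  "locally_bounded_on S F \<longleftrightarrow> (\<forall>K. compact K \<longrightarrow> K \<subseteq> S \<longrightarrow> bounded (F ` K))"

definition eventually_monotone :: "(real \<Rightarrow> real) \<Rightarrow> bool" where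
  "eventually_monotone G \<longleftrightarrow>
     (\<exists>T. monotone_on {T..} (\<le>) (\<le>) G \<or> monotone_on {T..} (\<le>) (\<ge>) G)"

definition M_inf_0 :: "real \<Rightarrow> (real \<Rightarrow> real) set" where
  "M_inf_0 \<kappa> = {F. locally_bounded_on {0..} F \<and> eventually_const_sign F \<and>
     eventually_monotone (\<lambda>t. t powr (- \<kappa>) * F t)}"

end

theory Submission
  imports Defs
begin

text \<open>
  Put \<open>L t = t\<^sup>-\<^sup>\<alpha> F t\<close> and \<open>H s = s\<^sup>-\<^sup>\<alpha> LS_transform F (1 / s)\<close>. Then \<open>F \<in> 2RV\<close> means
  \<open>(L (t x) / L t - 1) / A t \<rightarrow> ln x\<close>, and \<open>H s\<close> is the integral of \<open>u \<mapsto> L (s u)\<close> against the measure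
  \<open>e\<^sup>-\<^sup>u u\<^sup>\<alpha> du\<close>, with total mass \<open>c\<^sub>0\<close> and integral \<open>c\<^sub>1\<close> of the logarithm.

  In the Abelian direction, Potter-type bounds for \<open>L (s u) - L s\<close> allow dominated convergence, so
  \<open>(H s / L s - c\<^sub>0) / A s \<rightarrow> c\<^sub>1\<close>; this first-order correction does not affect the second-order limit.
  In the Tauberian direction, \<open>D\<^sub>s v = (c\<^sub>0 L (s v) / H s - 1) / A s\<close> is monotone in \<open>v\<close>, and the values of
  \<open>H\<close> at \<open>s / n\<close> give the limits of its integrals against all polynomials in \<open>e\<^sup>-\<^sup>v\<close>. As in Karamata's proof,
  Weierstrass approximation turns this into pointwise convergence \<open>D\<^sub>s v \<rightarrow> ln v - c\<^sub>1 / c\<^sub>0\<close>. Values of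
  \<open>F\<close> on a bounded interval change \<open>H s\<close> only by \<open>O(s\<^sup>-\<^sup>\<alpha>\<^sup>-\<^sup>1)\<close>, which is negligible against \<open>H s A s\<close>.
\<close>

section \<open>Second-order slow variation\<close>

text \<open>The limits are given pointwise for a merely measurable function, whereas dominated
  convergence needs bounds on \<open>L (s * u) - L s\<close> for all \<open>u\<close> at the scale
  \<open>A s * L s\<close>; measure estimates on one octave, followed by dyadic induction, supply
  them. In the Tauberian direction the obstacle is that \<open>D\<^sub>s\<close> has no sign.
  Weierstrass approximation costs the approximation error times the integral of
  \<open>\<bar>D\<^sub>s\<bar>\<close>. For a positive measure that integral is the moment of order
  0; here it must be bounded separately. Monotonicity yields the bound from the moments of orders 0
  and 1, through a kernel that changes sign exactly where the deviation of \<open>D\<^sub>s\<close>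
  from its central value does. Both directions end alike. They give
  \<open>H = L * (c\<^sub>0 + c\<^sub>1 * A + o(A))\<close> and \<open>L = H * (1 / c\<^sub>0 -
  c\<^sub>1 / c\<^sub>0\<^sup>2 * A + o(A))\<close>. Since \<open>A (t x) / A t\<close> tends to 1,
  the coefficient of \<open>A\<close> cancels between \<open>t x\<close> and \<open>t\<close>. The
  shift \<open>c\<^sub>1 / c\<^sub>0\<close> in the limit of \<open>D\<^sub>s\<close> is forced:
  division by \<open>H s\<close> makes the integral of \<open>D\<^sub>s\<close> tend to 0.\<close>

lemma measure_eventually_all_tendsto:
  fixes R :: "real \<Rightarrow> real \<Rightarrow> bool" and s :: "nat \<Rightarrow> real"
  assumes lim: "\<And>x. x \<in> {1..b} \<Longrightarrow> \<forall>\<^sub>F t in at_top. R t (t * x)"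
    and meas: "\<And>t. t > 0 \<Longrightarrow> {x \<in> {1..b}. R t (t * x)} \<in> sets lebesgue"
    and s: "filterlim s at_top sequentially" "\<And>n. s n > 0" and "1 \<le> b"
  shows "\<And>n. {x \<in> {1..b}. \<forall>m\<ge>n. R (s m) (s m * x)} \<in> sets lebesgue"
    and "(\<lambda>n. measure lebesgue {x \<in> {1..b}. \<forall>m\<ge>n. R (s m) (s m * x)}) \<longlonglongrightarrow> b - 1"
proof -
  \<comment> \<open>Following a sequence rather than all large \<open>t\<close> keeps these sets
    countable intersections, hence measurable. They increase to the whole interval, so continuity
    from below gives the limit of their measures.\<close>
  define V where "V n = {x \<in> {1..b}. \<forall>m\<ge>n. R (s m) (s m * x)}" for n
  have "V n = (\<Inter>m\<in>{n..}. {x \<in> {1..b}. R (s m) (s m * x)})" for n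
    by (auto simp: V_def)
  moreover have "(\<Inter>m\<in>{n..}. {x \<in> {1..b}. R (s m) (s m * x)}) \<in> sets lebesgue" for n
    using meas s(2) by (intro sets.countable_INT'') (auto intro!: exI[of _ n])
  ultimately have V: "V n \<in> sets lebesgue" for n by simp
  have inc: "incseq V"
    by (auto simp: incseq_def V_def)
  have U: "(\<Union>n. V n) = {1..b}"
  proof
    show "{1..b} \<subseteq> (\<Union>n. V n)"
    proof
      fix x assume x: "x \<in> {1..b}"
      have "\<forall>\<^sub>F n in sequentially. R (s n) (s n * x)"
        using lim[OF x] s(1) by (rule eventually_compose_filterlim)
      then obtain N where "\<forall>n\<ge>N. R (s n) (s n * x)"
        by (auto simp: eventually_sequentially)
      then show "x \<in> (\<Union>n. V n)" using x by (auto simp: V_def)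
    qed
  qed (auto simp: V_def)
  have "(\<lambda>n. measure lebesgue (V n)) \<longlonglongrightarrow> measure lebesgue (\<Union>n. V n)"
  proof (rule Lim_measure_incseq)
    show "emeasure lebesgue (\<Union>n. V n) \<noteq> \<infinity>"
      unfolding U using \<open>1 \<le> b\<close> by simp
  qed (use V inc in auto)
  moreover have "measure lebesgue {1..b} = b - 1"
    using \<open>1 \<le> b\<close> by simp
  ultimately show "(\<lambda>n. measure lebesgue {x \<in> {1..b}. \<forall>m\<ge>n. R (s m) (s m * x)}) \<longlonglongrightarrow> b - 1"
    unfolding U unfolding V_def by (simp only:)
  show "{x \<in> {1..b}. \<forall>m\<ge>n. R (s m) (s m * x)} \<in> sets lebesgue" for n
    using V unfolding V_def .
qed

text \<open>
  Takes the place of the uniform convergence theorem: two subsets of \<open>[t, 4 t]\<close>, the good points for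
  \<open>t\<close> and for \<open>t x\<close>, are too large to be disjoint.
\<close>

lemma eventually_common_point:
  fixes R :: "real \<Rightarrow> real \<Rightarrow> bool"
  assumes lim: "\<And>x. x \<in> {1..4} \<Longrightarrow> \<forall>\<^sub>F t in at_top. R t (t * x)"
    and meas: "\<And>t. t > 0 \<Longrightarrow> {x \<in> {1..4}. R t (t * x)} \<in> sets lebesgue"
  shows "\<forall>\<^sub>F t in at_top. \<forall>x\<in>{1..2}. \<exists>z. R t z \<and> R (t * x) z"
proof (rule ccontr)
  assume "\<not> ?thesis"
  then have "\<exists>t\<ge>N. \<exists>x\<in>{1..2}. \<forall>z. \<not> (R t z \<and> R (t * x) z)" for N
    by (auto simp: eventually_at_top_linorder)
  then have "\<exists>t x. t \<ge> real n + 1 \<and> x \<in> {1..2} \<and> (\<forall>z. \<not> (R t z \<and> R (t * x) z))" for n :: nat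
    by blast
  then obtain t x where t: "\<And>n::nat. t n \<ge> real n + 1" and x: "\<And>n. x n \<in> {1..2}"
    and neg: "\<And>n z. \<not> (R (t n) z \<and> R (t n * x n) z)"
    by metis
  have t_top: "filterlim t at_top sequentially"
    by (rule filterlim_at_top_mono[OF filterlim_real_sequentially])
      (use t in \<open>auto intro!: always_eventually order_trans[OF _ t]\<close>)
  have tpos: "t n > 0" for n using t[of n] by linarith
  have tx: "t n \<le> t n * x n" for n using x[of n] tpos[of n] by auto
  have tx_top: "filterlim (\<lambda>n. t n * x n) at_top sequentially"
    by (rule filterlim_at_top_mono[OF t_top]) (use tx in auto)
  \<comment> \<open>\<open>V n\<close> consists of multiples of \<open>t n\<close>,
    \<open>W n\<close> of multiples of \<open>t n * x n\<close>. Since \<open>x n\<close> and the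
    factors in \<open>W n\<close> are at most 2, their products stay within
    \<open>[1, 4]\<close>.\<close>
  define V where "V n = {u \<in> {1..4}. \<forall>m\<ge>n. R (t m) (t m * u)}" for n
  define W where "W n = {w \<in> {1..2}. \<forall>m\<ge>n. R (t m * x m) (t m * x m * w)}" for n
  have V: "V n \<in> sets lebesgue" for n
    unfolding V_def by (rule measure_eventually_all_tendsto(1)[OF lim meas t_top tpos]) auto
  have V_lim: "(\<lambda>n. measure lebesgue (V n)) \<longlonglongrightarrow> 4 - 1"
    unfolding V_def by (rule measure_eventually_all_tendsto(2)[OF lim meas t_top tpos]) auto
  have meas2: "{u \<in> {1..2}. R a (a * u)} \<in> sets lebesgue" if "a > 0" for a
  proof -
    have "{u \<in> {1..2}. R a (a * u)} = {u \<in> {1..4}. R a (a * u)} \<inter> {1..2}" by auto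
    then show ?thesis by (simp only:) (rule sets.Int[OF meas[OF that]], simp)
  qed
  have lim2: "\<forall>\<^sub>F t in at_top. R t (t * u)" if "u \<in> {1..2}" for u
    using that by (intro lim) auto
  have txpos: "t n * x n > 0" for n using tx[of n] tpos[of n] by linarith
  have W: "W n \<in> sets lebesgue" for n
    unfolding W_def by (rule measure_eventually_all_tendsto(1)[OF lim2 meas2 tx_top txpos]) auto
  have W_lim: "(\<lambda>n. measure lebesgue (W n)) \<longlonglongrightarrow> 2 - 1"
    unfolding W_def by (rule measure_eventually_all_tendsto(2)[OF lim2 meas2 tx_top txpos]) auto
  \<comment> \<open>The thresholds lie below the limits 3 and 1 and add up to 3, the length of
    \<open>[1, 4]\<close>.\<close>
  have "\<forall>\<^sub>F n in sequentially. measure lebesgue (V n) > 5/2"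
    by (rule order_tendstoD(1)[OF V_lim]) auto
  moreover have "\<forall>\<^sub>F n in sequentially. measure lebesgue (W n) > 1/2"
    by (rule order_tendstoD(1)[OF W_lim]) auto
  ultimately have "\<forall>\<^sub>F n in sequentially. measure lebesgue (V n) > 5/2 \<and> measure lebesgue (W n) > 1/2"
    by eventually_elim auto
  then obtain n where n: "measure lebesgue (V n) > 5/2" "measure lebesgue (W n) > 1/2"
    by (auto simp: eventually_sequentially)
  \<comment> \<open>Dilation by \<open>x n \<ge> 1\<close> expresses the second set in units of
    \<open>t n\<close> without decreasing its measure, so that it can be compared with
    \<open>V n\<close>.\<close>
  define X where "X = (\<lambda>w. x n *\<^sub>R w + 0) ` W n"
  have xn: "1 \<le> x n" "x n \<le> 2" using x[of n] by auto
  have X_sets: "X \<in> sets lebesgue"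
    unfolding X_def using W
    by (intro differentiable_image_in_sets_lebesgue) (auto intro!: derivative_intros)
  have "measure lebesgue X = x n * measure lebesgue (W n)"
    unfolding X_def by (subst measure_lebesgue_affine) (use xn in auto)
  then have X_meas: "measure lebesgue X > 1/2"
    using n(2) mult_right_mono[OF xn(1) measure_nonneg[of lebesgue "W n"]] by linarith
  have disj: "V n \<inter> X = {}"
  proof (rule ccontr)
    assume "V n \<inter> X \<noteq> {}"
    then obtain w where "w \<in> W n" "x n * w \<in> V n" by (auto simp: X_def)
    then show False using neg[of n "t n * x n * w"] by (auto simp: V_def W_def mult.assoc)
  qed
  have X_sub: "X \<subseteq> {1..4}"
  proof
    fix u assume "u \<in> X"
    then obtain w where w: "1 \<le> w" "w \<le> 2" "u = x n * w" by (auto simp: X_def W_def)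
    then show "u \<in> {1..4}" using xn mult_mono[of 1 "x n" 1 w] mult_mono[of "x n" 2 w 2] by auto
  qed
  have Icc: "{1..4::real} \<in> fmeasurable lebesgue"
    using lmeasurable_cbox[of 1 "4::real"] by simp
  have V_sub: "V n \<subseteq> {1..4}" unfolding V_def by blast
  have fin: "V n \<in> fmeasurable lebesgue" "X \<in> fmeasurable lebesgue"
    using fmeasurableI2[OF Icc V_sub V] fmeasurableI2[OF Icc X_sub X_sets] by blast+
  have "measure lebesgue (V n) + measure lebesgue X = measure lebesgue (V n \<union> X)"
    using measure_Un3[OF fin] unfolding disj by (simp only: measure_empty diff_0_right)
  also have "\<dots> \<le> measure lebesgue {1..4::real}"
    using X_sub V_sub X_sets V[of n] Icc by (intro measure_mono_fmeasurable) blast+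
  finally show False using n X_meas by simp
qed

lemma eventually_at_top_scale:
  fixes P :: "real \<Rightarrow> bool"
  assumes "eventually P at_top" "x > 0"
  shows "\<forall>\<^sub>F t in at_top. P (t * x)"
  using assms(1)
proof (rule eventually_compose_filterlim)
  show "filterlim (\<lambda>t. t * x) at_top at_top"
    using assms(2) by (intro filterlim_at_top_mult_tendsto_pos[OF tendsto_const] filterlim_ident)
qed

text \<open>Lebesgue measurability does not survive composition with arbitrary Borel maps. A
  dilation preserves it, and extension by zero reduces the claim to an affine map of the whole
  line.\<close>

lemma borel_measurable_lebesgue_on_scale:
  fixes f :: "real \<Rightarrow> real"
  assumes "f \<in> borel_measurable (lebesgue_on {0<..})" "s > 0"
  shows "(\<lambda>x. f (s * x)) \<in> borel_measurable (lebesgue_on {0<..})"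
proof -
  have "(\<lambda>x. if x \<in> {0<..} then f x else 0) \<in> borel_measurable lebesgue"
    using assms(1) by (subst borel_measurable_if) auto
  then have "(\<lambda>x. if 0 + s *\<^sub>R x \<in> {0<..} then f (0 + s *\<^sub>R x) else 0) \<in> borel_measurable lebesgue"
    using borel_measurable_affine[of "\<lambda>x. if x \<in> {0<..} then f x else 0" s 0] \<open>s > 0\<close> by simp
  also have "(\<lambda>x. if 0 + s *\<^sub>R x \<in> {0<..} then f (0 + s *\<^sub>R x) else 0)
      = (\<lambda>x. if x \<in> {0<..} then f (s * x) else 0)"
    using \<open>s > 0\<close> by (auto simp: fun_eq_iff zero_less_mult_iff)
  finally show ?thesis by (subst (asm) borel_measurable_if) auto
qed

section \<open>Dyadic induction for Potter-type bounds\<close>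

text \<open>Halve \<open>u\<close> until it is at most 2. Each halving costs exactly
  \<open>2 powr \<epsilon>\<close>, so the local constant \<open>K\<close> is paid once, at the last
  factor in \<open>[1, 2]\<close>, and does not accumulate with the number of steps.\<close>

lemma dyadic_lower_bound:
  fixes f :: "real \<Rightarrow> real"
  assumes "T > 0" "\<epsilon> \<ge> 0" and pos: "\<And>t. t \<ge> T \<Longrightarrow> f t \<ge> 0" and "K \<ge> 0"
    and double: "\<And>t. t \<ge> T \<Longrightarrow> f t \<le> 2 powr \<epsilon> * f (t * 2)"
    and loc: "\<And>t x. t \<ge> T \<Longrightarrow> x \<in> {1..2} \<Longrightarrow> f t \<le> K * f (t * x)"
    and "t \<ge> T" "u \<ge> 1"
  shows "f t \<le> K * u powr \<epsilon> * f (t * u)"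
proof -
  have "f t \<le> K * u powr \<epsilon> * f (t * u)" if "t \<ge> T" "1 \<le> u" "u \<le> 2 ^ n" for n t u
    using that
  proof (induction n arbitrary: t u)
    case 0
    then show ?case using loc[of t 1] by simp
  next
    case (Suc n)
    show ?case
    proof (cases "u \<le> 2")
      case True
      have tu: "t * u \<ge> T"
        using Suc.prems \<open>T > 0\<close> mult_mono[of T t 1 u] by simp
      have "f t \<le> K * f (t * u)" using loc[of t u] True Suc.prems by simp
      also have "\<dots> \<le> K * f (t * u) * u powr \<epsilon>"
        using Suc.prems assms(2) pos[OF tu] \<open>K \<ge> 0\<close> mult_left_mono[of 1 "u powr \<epsilon>" "K * f (t * u)"]
        by (simp add: ge_one_powr_ge_zero)
      finally show ?thesis by (simp add: mult_ac)
    next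
      case False
      have "f t \<le> 2 powr \<epsilon> * f (t * 2)" using double Suc.prems by simp
      also have "\<dots> \<le> 2 powr \<epsilon> * (K * (u / 2) powr \<epsilon> * f (t * 2 * (u / 2)))"
        using Suc.prems False \<open>T > 0\<close> by (intro mult_left_mono Suc.IH) auto
      also have "\<dots> = K * u powr \<epsilon> * f (t * u)"
        using False by (simp add: powr_divide)
      finally show ?thesis .
    qed
  qed
  moreover obtain n where "u \<le> 2 ^ n"
    using real_arch_pow[of 2 u] by (auto intro: less_imp_le)
  ultimately show ?thesis using assms by blast
qed

text \<open>The increment telescopes over doublings. Letting \<open>f\<close> grow only at rate
  \<open>\<epsilon> / 2\<close> leaves the gap
  \<open>2 powr \<epsilon> - 2 powr (\<epsilon> / 2)\<close>, and the second condition on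
  \<open>K\<close> lets this gap absorb the first step \<open>C * f t\<close>.\<close>

lemma dyadic_increment_bound:
  fixes f L :: "real \<Rightarrow> real"
  assumes "T > 0" "0 < \<epsilon>" and pos: "\<And>t. t \<ge> T \<Longrightarrow> f t \<ge> 0" and "C \<ge> 0"
    and double: "\<And>t. t \<ge> T \<Longrightarrow> f (t * 2) \<le> 2 powr (\<epsilon> / 2) * f t"
    and loc: "\<And>t x. t \<ge> T \<Longrightarrow> x \<in> {1..2} \<Longrightarrow> \<bar>L (t * x) - L t\<bar> \<le> C * f t"
    and K: "K \<ge> C" "K * (2 powr \<epsilon> - 2 powr (\<epsilon> / 2)) \<ge> C"
    and "t \<ge> T" "u \<ge> 1"
  shows "\<bar>L (t * u) - L t\<bar> \<le> K * u powr \<epsilon> * f t"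
proof -
  have "\<bar>L (t * u) - L t\<bar> \<le> K * u powr \<epsilon> * f t" if "t \<ge> T" "1 \<le> u" "u \<le> 2 ^ n" for n t u
    using that
  proof (induction n arbitrary: t u)
    case 0
    then show ?case using loc[of t 1] pos K \<open>C \<ge> 0\<close> by simp
  next
    case (Suc n)
    have one: "1 \<le> u powr \<epsilon>" using Suc.prems \<open>\<epsilon> > 0\<close> by (simp add: ge_one_powr_ge_zero)
    show ?case
    proof (cases "u \<le> 2")
      case True
      have "\<bar>L (t * u) - L t\<bar> \<le> C * f t" using loc[of t u] True Suc.prems by simp
      also have "\<dots> \<le> K * u powr \<epsilon> * f t"
        using one K \<open>C \<ge> 0\<close> mult_mono[of C K 1 "u powr \<epsilon>"] pos[OF \<open>t \<ge> T\<close>]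
        by (intro mult_right_mono) auto
      finally show ?thesis .
    next
      case False
      define v where "v = u / 2"
      have v: "1 \<le> v" "v \<le> 2 ^ n" "u = 2 * v" using False Suc.prems by (auto simp: v_def)
      have one: "1 \<le> v powr \<epsilon>" using v \<open>\<epsilon> > 0\<close> by (simp add: ge_one_powr_ge_zero)
      have "\<bar>L (t * 2 * v) - L (t * 2)\<bar> \<le> K * v powr \<epsilon> * f (t * 2)"
        using Suc.prems \<open>T > 0\<close> v by (intro Suc.IH) auto
      also have "\<dots> \<le> K * v powr \<epsilon> * (2 powr (\<epsilon> / 2) * f t)"
        using K \<open>C \<ge> 0\<close> Suc.prems by (intro mult_left_mono double) auto
      finally have "\<bar>L (t * u) - L t\<bar> \<le> K * v powr \<epsilon> * (2 powr (\<epsilon> / 2) * f t) + C * f t"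
        using loc[of t 2] Suc.prems v by (simp add: mult.assoc)
      also have "C * f t \<le> (K * (2 powr \<epsilon> - 2 powr (\<epsilon> / 2))) * v powr \<epsilon> * f t"
        using one K \<open>C \<ge> 0\<close> pos[OF \<open>t \<ge> T\<close>]
          mult_mono[OF K(2), of 1 "v powr \<epsilon>"]
        by (intro mult_right_mono) auto
      also have "K * v powr \<epsilon> * (2 powr (\<epsilon> / 2) * f t) + \<dots> = K * u powr \<epsilon> * f t"
        using v by (simp add: powr_mult algebra_simps)
      finally show ?thesis by simp
    qed
  qed
  moreover obtain n where "u \<le> 2 ^ n"
    using real_arch_pow[of 2 u] by (auto intro: less_imp_le)
  ultimately show ?thesis using assms by blast
qed

section \<open>Bounds and comparison principle for second-order slow variation\<close>

locale null_slowly_varying =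
  fixes A :: "real \<Rightarrow> real"
  assumes A_measurable: "A \<in> borel_measurable (lebesgue_on {0<..})"
    and A_sign: "eventually_const_sign A"
    and A_tendsto: "(A \<longlongrightarrow> 0) at_top"
    and A_ratio: "\<And>x. x > 0 \<Longrightarrow> ((\<lambda>t. A (t * x) / A t) \<longlongrightarrow> 1) at_top"

begin

lemma A_nonzero: "\<forall>\<^sub>F t in at_top. A t \<noteq> 0"
  using A_sign unfolding eventually_const_sign_def by (auto elim: eventually_mono)

end

text \<open>Both directions lead from one instance of this locale to another with the same
  \<open>A\<close>, with the normalised function and its transform exchanging places. Dividing out
  the power makes the limit \<open>ln x\<close> whatever the index.\<close>

locale second_order_slow = null_slowly_varying +
  fixes L :: "real \<Rightarrow> real"
  assumes L_measurable: "L \<in> borel_measurable (lebesgue_on {0<..})"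
    and L_pos: "\<forall>\<^sub>F t in at_top. L t > 0"
    and L_second_order: "\<And>x. x > 0 \<Longrightarrow> ((\<lambda>t. (L (t * x) / L t - 1) / A t) \<longlongrightarrow> ln x) at_top"
begin

lemma L_ratio:
  assumes "x > 0"
  shows "((\<lambda>t. L (t * x) / L t) \<longlongrightarrow> 1) at_top"
proof -
  have "((\<lambda>t. 1 + A t * ((L (t * x) / L t - 1) / A t)) \<longlongrightarrow> 1 + 0 * ln x) at_top"
    by (intro tendsto_intros A_tendsto L_second_order assms)
  moreover have "\<forall>\<^sub>F t in at_top. 1 + A t * ((L (t * x) / L t - 1) / A t) = L (t * x) / L t"
    using A_nonzero by eventually_elim simp
  ultimately show ?thesis
    by (auto elim: Lim_transform_eventually)
qed

text \<open>\<open>L t\<close> and \<open>L (t * x)\<close> are compared through a point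
  \<open>z\<close> that is good for both. The factors 2 in \<open>R\<close> combine to 4 for
  \<open>A\<close>; with \<open>\<bar>A\<bar> < 1/32\<close> they give 2 for \<open>L\<close>; and
  \<open>18 = 2 + 2 * (4 * 2)\<close> adds the errors on the two sides of \<open>z\<close>.\<close>

lemma local_bounds:
  "\<forall>\<^sub>F t in at_top. \<forall>x\<in>{1..2}. \<bar>A t\<bar> \<le> 4 * \<bar>A (t * x)\<bar> \<and> L t \<le> 2 * L (t * x)
     \<and> \<bar>L (t * x) - L t\<bar> \<le> 18 * (\<bar>A t\<bar> * L t)"
proof -
  define R where "R t z \<longleftrightarrow> \<bar>A z\<bar> \<le> 2 * \<bar>A t\<bar> \<and> \<bar>A t\<bar> \<le> 2 * \<bar>A z\<bar> \<and> \<bar>L z - L t\<bar> \<le> 2 * (\<bar>A t\<bar> * L t)"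
    for t z
  have "\<forall>\<^sub>F t in at_top. \<forall>x\<in>{1..2}. \<exists>z. R t z \<and> R (t * x) z"
  proof (rule eventually_common_point)
    fix x :: real assume x: "x \<in> {1..4}"
    \<comment> \<open>As \<open>ln 4 < 2\<close>, the constant 2 in \<open>R\<close> strictly
      dominates the limits of the second-order quotient on \<open>[1, 4]\<close>.\<close>
    have "ln 4 = 2 * ln (2::real)" using ln_realpow[of "2::real" 2] by simp
    then have "ln x < 2" using x ln2_le_25_over_36 ln_le_cancel_iff[of x 4] by auto
    moreover have "0 \<le> ln x" by (rule ln_ge_zero) (use x in auto)
    then have "-2 < ln x" by linarith
    ultimately have "\<forall>\<^sub>F t in at_top. (L (t * x) / L t - 1) / A t < 2"
        "\<forall>\<^sub>F t in at_top. (L (t * x) / L t - 1) / A t > -2"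
      using order_tendstoD[OF L_second_order[of x]] x by auto
    moreover have "\<forall>\<^sub>F t in at_top. A (t * x) / A t < 2" "\<forall>\<^sub>F t in at_top. A (t * x) / A t > 1/2"
      using order_tendstoD(2)[OF A_ratio[of x], of 2] order_tendstoD(1)[OF A_ratio[of x], of "1/2"] x
      by simp_all
    ultimately show "\<forall>\<^sub>F t in at_top. R t (t * x)" using A_nonzero L_pos
    proof eventually_elim
      case (elim t)
      have nz: "A t \<noteq> 0" "L t > 0" using elim by auto
      have "\<bar>(L (t * x) / L t - 1) / A t\<bar> \<le> 2" using elim by linarith
      moreover have "(L (t * x) / L t - 1) / A t = (L (t * x) - L t) / (A t * L t)"
        using nz by (simp add: field_simps)
      ultimately have "\<bar>L (t * x) - L t\<bar> \<le> 2 * (\<bar>A t\<bar> * L t)"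
        using nz by (simp add: abs_mult divide_le_eq)
      moreover have "\<bar>A (t * x) / A t\<bar> \<le> 2" "\<bar>A (t * x) / A t\<bar> \<ge> 1/2" using elim by linarith+
      then have "\<bar>A (t * x)\<bar> \<le> 2 * \<bar>A t\<bar>" "\<bar>A t\<bar> \<le> 2 * \<bar>A (t * x)\<bar>"
        using nz by (auto simp: abs_divide divide_le_eq le_divide_eq)
      ultimately show ?case by (simp add: R_def)
    qed
  next
    fix t :: real assume t: "t > 0"
    have [measurable]: "(\<lambda>x. A (t * x)) \<in> borel_measurable (lebesgue_on {0<..})"
      "(\<lambda>x. L (t * x)) \<in> borel_measurable (lebesgue_on {0<..})"
      using t A_measurable L_measurable by (auto intro: borel_measurable_lebesgue_on_scale)
    have "{x \<in> space (lebesgue_on {0<..}). R t (t * x)} \<in> sets (lebesgue_on {0<..})"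
      unfolding R_def by measurable
    then have "{x \<in> {0<..}. R t (t * x)} \<in> sets lebesgue"
      by (subst (asm) sets_restrict_space_iff) auto
    then have "{x \<in> {0<..}. R t (t * x)} \<inter> {1..4} \<in> sets lebesgue"
      by (rule sets.Int) simp
    also have "{x \<in> {0<..}. R t (t * x)} \<inter> {1..4} = {x \<in> {1..4}. R t (t * x)}" by auto
    finally show "{x \<in> {1..4}. R t (t * x)} \<in> sets lebesgue" .
  qed
  moreover have "\<forall>\<^sub>F t in at_top. \<bar>A t\<bar> < 1/32"
    using order_tendstoD(2)[OF tendsto_rabs_zero[OF A_tendsto], of "1/32"] by simp
  with L_pos A_nonzero have "\<forall>\<^sub>F t in at_top. A t \<noteq> 0 \<and> L t > 0 \<and> \<bar>A t\<bar> < 1/32"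
    by eventually_elim auto
  then have "\<forall>\<^sub>F t in at_top. \<forall>s\<ge>t. A s \<noteq> 0 \<and> L s > 0 \<and> \<bar>A s\<bar> < 1/32"
    by (rule eventually_all_ge_at_top)
  ultimately show ?thesis using eventually_gt_at_top[of 0]
  proof eventually_elim
    case (elim t)
    show ?case
    proof
      fix x :: real assume x: "x \<in> {1..2}"
      then obtain z where z: "R t z" "R (t * x) z" using elim(1) by blast
      have tx: "t * x \<ge> t" using x elim(3) by simp
      have pos: "L t > 0" "L (t * x) > 0" and A32: "\<bar>A t\<bar> < 1/32" "\<bar>A (t * x)\<bar> < 1/32"
        using elim(2) tx by blast+
      have A4: "\<bar>A (t * x)\<bar> \<le> 4 * \<bar>A t\<bar>" "\<bar>A t\<bar> \<le> 4 * \<bar>A (t * x)\<bar>" using z by (simp_all add: R_def)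
      have 1: "\<bar>L z - L t\<bar> \<le> 2 * (\<bar>A t\<bar> * L t)" "\<bar>L z - L (t * x)\<bar> \<le> 2 * (\<bar>A (t * x)\<bar> * L (t * x))"
        using z by (simp_all add: R_def)
      have 2: "\<bar>A t\<bar> * L t \<le> 1/32 * L t" "\<bar>A (t * x)\<bar> * L (t * x) \<le> 1/32 * L (t * x)"
        using pos A32 by (intro mult_right_mono; simp)+
      have L2: "L (t * x) \<le> 2 * L t" "L t \<le> 2 * L (t * x)" using 1 2 pos by linarith+
      have "\<bar>A (t * x)\<bar> * L (t * x) \<le> (4 * \<bar>A t\<bar>) * (2 * L t)"
        using A4 L2 pos by (intro mult_mono) auto
      then have "\<bar>L (t * x) - L t\<bar> \<le> 18 * (\<bar>A t\<bar> * L t)" using 1 by linarith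
      with A4 L2 show "\<bar>A t\<bar> \<le> 4 * \<bar>A (t * x)\<bar> \<and> L t \<le> 2 * L (t * x)
          \<and> \<bar>L (t * x) - L t\<bar> \<le> 18 * (\<bar>A t\<bar> * L t)" by blast
    qed
  qed
qed

text \<open>The scale \<open>\<bar>A\<bar> * L\<close> is itself slowly varying, so its doubling
  ratio eventually lies between \<open>2 powr (- \<epsilon>)\<close> and
  \<open>2 powr (\<epsilon> / 2)\<close>, which feeds both dyadic lemmas. The last bound treats
  increments to the right; combined with the comparison of scales it also controls increments to the
  left.\<close>

theorem potter_bounds:
  assumes "\<epsilon> > 0"
  obtains T K where "T > 0" "K > 0" "\<And>t. t \<ge> T \<Longrightarrow> A t \<noteq> 0 \<and> L t > 0"
    "\<And>t u. t \<ge> T \<Longrightarrow> u \<ge> 1 \<Longrightarrow> \<bar>A t\<bar> * L t \<le> K * u powr \<epsilon> * (\<bar>A (t * u)\<bar> * L (t * u))"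
    "\<And>t u. t \<ge> T \<Longrightarrow> u \<ge> 1 \<Longrightarrow> \<bar>L (t * u) - L t\<bar> \<le> K * u powr \<epsilon> * (\<bar>A t\<bar> * L t)"
proof -
  define f where "f t = \<bar>A t\<bar> * L t" for t
  have lim: "((\<lambda>t. \<bar>A (t * 2) / A t\<bar> * (L (t * 2) / L t)) \<longlongrightarrow> \<bar>1\<bar> * 1) at_top"
    by (intro tendsto_intros A_ratio L_ratio) auto
  have "2 powr (\<epsilon> / 2) > 1" using assms by simp
  moreover have "2 powr (- \<epsilon>) < 1" using assms by (simp add: powr_less_one)
  ultimately have "\<forall>\<^sub>F t in at_top. \<bar>A (t * 2) / A t\<bar> * (L (t * 2) / L t) < 2 powr (\<epsilon> / 2)"
    "\<forall>\<^sub>F t in at_top. \<bar>A (t * 2) / A t\<bar> * (L (t * 2) / L t) > 2 powr (- \<epsilon>)"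
    using order_tendstoD[OF lim] by simp_all
  with L_pos A_nonzero local_bounds have "\<forall>\<^sub>F t in at_top. A t \<noteq> 0 \<and> L t > 0 \<and>
    f (t * 2) \<le> 2 powr (\<epsilon> / 2) * f t \<and> f t \<le> 2 powr \<epsilon> * f (t * 2) \<and>
    (\<forall>x\<in>{1..2}. f t \<le> 8 * f (t * x) \<and> \<bar>L (t * x) - L t\<bar> \<le> 18 * f t)"
  proof eventually_elim
    case (elim t)
    have eq: "\<bar>A (t * 2) / A t\<bar> * (L (t * 2) / L t) = f (t * 2) / f t" by (simp add: f_def)
    have "f t > 0" using elim by (simp add: f_def)
    have q: "f (t * 2) / f t < 2 powr (\<epsilon> / 2)" "2 powr (- \<epsilon>) < f (t * 2) / f t"
      using elim unfolding eq by blast+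
    have "f (t * 2) \<le> 2 powr (\<epsilon> / 2) * f t"
      using q(1) \<open>f t > 0\<close> by (simp add: divide_less_eq)
    moreover have "f t \<le> 2 powr \<epsilon> * f (t * 2)"
    proof -
      have "2 powr (- \<epsilon>) * f t \<le> f (t * 2)"
        using q(2) \<open>f t > 0\<close> by (simp add: less_divide_eq)
      then have "2 powr \<epsilon> * (2 powr (- \<epsilon>) * f t) \<le> 2 powr \<epsilon> * f (t * 2)"
        by (intro mult_left_mono) auto
      moreover have "2 powr \<epsilon> * 2 powr (- \<epsilon>) = 1" by (simp add: powr_add[symmetric])
      ultimately show ?thesis by (simp only: mult.assoc[symmetric] mult_1_left)
    qed
    moreover have "f t \<le> 8 * f (t * x)" if "x \<in> {1..2}" for x
      using mult_mono[of "\<bar>A t\<bar>" "4 * \<bar>A (t * x)\<bar>" "L t" "2 * L (t * x)"] elim that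
      by (auto simp: f_def)
    moreover have "\<bar>L (t * x) - L t\<bar> \<le> 18 * f t" if "x \<in> {1..2}" for x
      using elim that by (simp add: f_def)
    ultimately show ?case using elim by blast
  qed
  then obtain T0 where T0: "\<And>t. t \<ge> T0 \<Longrightarrow> A t \<noteq> 0 \<and> L t > 0 \<and>
    f (t * 2) \<le> 2 powr (\<epsilon> / 2) * f t \<and> f t \<le> 2 powr \<epsilon> * f (t * 2) \<and>
    (\<forall>x\<in>{1..2}. f t \<le> 8 * f (t * x) \<and> \<bar>L (t * x) - L t\<bar> \<le> 18 * f t)"
    unfolding eventually_at_top_linorder by blast
  define T where "T = max T0 1"
  \<comment> \<open>The gap in the increment bound with \<open>C = 18\<close>. The \<open>K\<close>
    below satisfies both conditions \<open>K \<ge> 18\<close> and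
    \<open>K * \<delta> \<ge> 18\<close>, and it covers the constant \<open>8 = 4 * 2\<close> of the
    lower bound.\<close>
  define \<delta> where "\<delta> = 2 powr \<epsilon> - 2 powr (\<epsilon> / 2)"
  define K where "K = 18 + 18 / \<delta>"
  have "\<delta> > 0" using assms by (simp add: \<delta>_def)
  have K: "K \<ge> 18" "K * \<delta> \<ge> 18" using \<open>\<delta> > 0\<close> by (auto simp: K_def algebra_simps)
  have f: "f t \<ge> 0" if "t \<ge> T" for t using T0[of t] that by (auto simp: f_def T_def)
  show ?thesis
  proof (rule that)
    show "T > 0" "K > 0" using K by (auto simp: T_def)
    show "A t \<noteq> 0 \<and> L t > 0" if "t \<ge> T" for t using T0[of t] that by (auto simp: T_def)
    fix t u :: real assume tu: "t \<ge> T" "u \<ge> 1"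
    then have "T \<le> t * u" using \<open>T > 0\<close> mult_mono[of T t 1 u] by simp
    have "f t \<le> 8 * u powr \<epsilon> * f (t * u)"
      by (rule dyadic_lower_bound[where T = T]) (use T0 tu f assms in \<open>auto simp: T_def\<close>)
    also have "\<dots> \<le> K * u powr \<epsilon> * f (t * u)"
      using K f[OF \<open>T \<le> t * u\<close>] by (intro mult_right_mono) auto
    finally show "\<bar>A t\<bar> * L t \<le> K * u powr \<epsilon> * (\<bar>A (t * u)\<bar> * L (t * u))"
      by (simp add: f_def)
    have "\<bar>L (t * u) - L t\<bar> \<le> K * u powr \<epsilon> * f t"
      by (rule dyadic_increment_bound[where T = T and C = 18])
        (use T0 tu f assms K in \<open>auto simp: T_def \<delta>_def\<close>)
    then show "\<bar>L (t * u) - L t\<bar> \<le> K * u powr \<epsilon> * (\<bar>A t\<bar> * L t)" by (simp add: f_def)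
  qed
qed

text \<open>Started at the fixed point \<open>T\<close>, the comparison of scales says that
  \<open>\<bar>A\<bar> * L\<close> decays no faster than a small negative power. Half of
  \<open>\<delta>\<close> pays for this decay and the other half diverges. Errors of order
  \<open>s powr (- \<alpha> - 1)\<close> thereby become negligible at second order.\<close>

lemma power_times_A_L_at_top:
  assumes "\<delta> > 0"
  shows "filterlim (\<lambda>t. t powr \<delta> * (\<bar>A t\<bar> * L t)) at_top at_top"
proof -
  obtain T K where TK: "T > 0" "K > 0" "\<And>t. t \<ge> T \<Longrightarrow> A t \<noteq> 0 \<and> L t > 0"
    "\<And>t u. t \<ge> T \<Longrightarrow> u \<ge> 1 \<Longrightarrow> \<bar>A t\<bar> * L t \<le> K * u powr (\<delta> / 2) * (\<bar>A (t * u)\<bar> * L (t * u))"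
    using potter_bounds[of "\<delta> / 2"] assms by (metis half_gt_zero)
  define c where "c = \<bar>A T\<bar> * L T / K * T powr (\<delta> / 2)"
  have "c > 0" using TK(1,2) TK(3)[of T] by (simp add: c_def)
  have "filterlim (\<lambda>t. c * t powr (\<delta> / 2)) at_top at_top"
    using \<open>c > 0\<close> assms by (intro filterlim_tendsto_pos_mult_at_top[OF tendsto_const] real_powr_at_top) auto
  then show ?thesis
  proof (rule filterlim_at_top_mono)
    show "\<forall>\<^sub>F t in at_top. c * t powr (\<delta> / 2) \<le> t powr \<delta> * (\<bar>A t\<bar> * L t)"
      using eventually_ge_at_top[of T]
    proof eventually_elim
      case (elim t)
      have "\<bar>A T\<bar> * L T \<le> K * (t / T) powr (\<delta> / 2) * (\<bar>A t\<bar> * L t)"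
        using TK(4)[of T "t / T"] elim TK(1) by simp
      also have "\<dots> = (K / T powr (\<delta> / 2)) * (t powr (\<delta> / 2) * (\<bar>A t\<bar> * L t))"
        using elim TK(1) by (simp add: powr_divide)
      finally have "c \<le> t powr (\<delta> / 2) * (\<bar>A t\<bar> * L t)"
        using TK(1,2) by (simp add: c_def field_simps)
      then have "c * t powr (\<delta> / 2) \<le> t powr (\<delta> / 2) * (\<bar>A t\<bar> * L t) * t powr (\<delta> / 2)"
        by (intro mult_right_mono) auto
      also have "\<dots> = (t powr (\<delta> / 2) * t powr (\<delta> / 2)) * (\<bar>A t\<bar> * L t)"
        by (simp only: mult_ac)
      also have "t powr (\<delta> / 2) * t powr (\<delta> / 2) = t powr \<delta>"
        by (simp add: powr_add[symmetric])
      finally show ?case .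
    qed
  qed
qed

text \<open>With \<open>r = M / L\<close>, both \<open>r t\<close> and \<open>r (t * x)\<close> are
  \<open>c + d * A t + o(A t)\<close>, because \<open>A\<close> is slowly varying. Their difference
  is \<open>o(A t)\<close>, so the factor \<open>r\<close> leaves the second-order limit of
  \<open>M = r * L\<close> unchanged.\<close>

lemma second_order_transfer:
  fixes M :: "real \<Rightarrow> real"
  assumes "c > 0" and lim: "((\<lambda>t. (M t / L t - c) / A t) \<longlongrightarrow> d) at_top" and "x > 0"
  shows "((\<lambda>t. (M (t * x) / M t - 1) / A t) \<longlongrightarrow> ln x) at_top"
    and "\<forall>\<^sub>F t in at_top. M t > 0"
proof -
  define r where "r t = M t / L t" for t
  have "((\<lambda>t. c + A t * ((r t - c) / A t)) \<longlongrightarrow> c + 0 * d) at_top"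
    using lim unfolding r_def by (intro tendsto_intros A_tendsto)
  moreover have "\<forall>\<^sub>F t in at_top. c + A t * ((r t - c) / A t) = r t"
    using A_nonzero by eventually_elim simp
  ultimately have r_lim: "(r \<longlongrightarrow> c) at_top"
    by (auto elim: Lim_transform_eventually)
  have r_pos: "\<forall>\<^sub>F t in at_top. r t > 0" using order_tendstoD(1)[OF r_lim] \<open>c > 0\<close> .
  then show Mpos: "\<forall>\<^sub>F t in at_top. M t > 0" using L_pos
    by eventually_elim (auto simp: r_def zero_less_divide_iff)
  have scale: "filterlim (\<lambda>t. t * x) at_top at_top"
    using eventually_at_top_scale \<open>x > 0\<close> by (auto simp: filterlim_iff)
  have lim': "((\<lambda>t. (r (t * x) - c) / A (t * x)) \<longlongrightarrow> d) at_top"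
    using filterlim_compose[OF lim scale] by (simp add: r_def)
  have "((\<lambda>t. ((r (t * x) - c) / A (t * x)) * (A (t * x) / A t) / r t - ((r t - c) / A t) / r t)
      \<longlongrightarrow> d * 1 / c - d / c) at_top"
    using lim \<open>c > 0\<close> unfolding r_def[symmetric]
    by (intro tendsto_intros lim' A_ratio r_lim \<open>x > 0\<close>) auto
  moreover have "\<forall>\<^sub>F t in at_top. ((r (t * x) - c) / A (t * x)) * (A (t * x) / A t) / r t - ((r t - c) / A t) / r t
      = (r (t * x) / r t - 1) / A t"
    using A_nonzero r_pos eventually_at_top_scale[OF A_nonzero \<open>x > 0\<close>]
    by eventually_elim (simp add: field_simps)
  ultimately have r2: "((\<lambda>t. (r (t * x) / r t - 1) / A t) \<longlongrightarrow> 0) at_top"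
    by (auto elim: Lim_transform_eventually)
  have r_ratio: "((\<lambda>t. r (t * x) / r t) \<longlongrightarrow> c / c) at_top"
    using \<open>c > 0\<close> by (intro tendsto_intros r_lim filterlim_compose[OF r_lim scale]) auto
  \<comment> \<open>Discrete product rule: for ratios \<open>a\<close> of \<open>L\<close> and
    \<open>b\<close> of \<open>r\<close>, \<open>a * b - 1 = (a - 1) * b + (b - 1)\<close>.\<close>
  have "((\<lambda>t. (L (t * x) / L t - 1) / A t * (r (t * x) / r t) + (r (t * x) / r t - 1) / A t)
      \<longlongrightarrow> ln x * (c / c) + 0) at_top"
    by (intro tendsto_intros r2 r_ratio L_second_order \<open>x > 0\<close>)
  moreover have "\<forall>\<^sub>F t in at_top. (L (t * x) / L t - 1) / A t * (r (t * x) / r t) + (r (t * x) / r t - 1) / A t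
      = (M (t * x) / M t - 1) / A t"
    using A_nonzero Mpos L_pos eventually_at_top_scale[OF L_pos \<open>x > 0\<close>]
  proof eventually_elim
    case (elim t)
    have "M (t * x) / M t = (L (t * x) / L t) * (r (t * x) / r t)"
      using elim by (simp add: r_def)
    then show ?case by (simp add: add_divide_distrib[symmetric] algebra_simps)
  qed
  ultimately show "((\<lambda>t. (M (t * x) / M t - 1) / A t) \<longlongrightarrow> ln x) at_top"
    using \<open>c > 0\<close> by (auto elim: Lim_transform_eventually)
qed

end

section \<open>The measure with density \<open>exp (- u) * u powr \<alpha>\<close>\<close>

text \<open>The unnormalised Gamma law; for \<open>\<alpha> > -1\<close> its mass is
  \<open>Gamma (\<alpha> + 1)\<close>. It lives on Lebesgue sets because \<open>F\<close> is only
  Lebesgue measurable, and its space omits 0, where \<open>powr\<close> has the conventional value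
  0.\<close>

definition gamma_measure :: "real \<Rightarrow> real measure" where
  "gamma_measure \<alpha> = density (lebesgue_on {0<..}) (\<lambda>u. ennreal (exp (- u) * u powr \<alpha>))"

lemma space_gamma_measure [simp]: "space (gamma_measure \<alpha>) = {0<..}"
  by (simp add: gamma_measure_def)

lemma sets_gamma_measure [measurable_cong]: "sets (gamma_measure \<alpha>) = sets (lebesgue_on {0<..})"
  by (simp add: gamma_measure_def)

lemma borel_imp_lebesgue_on [measurable (raw)]:
  "f \<in> borel_measurable borel \<Longrightarrow> f \<in> borel_measurable (lebesgue_on S)"
  by (intro measurable_restrict_space1 measurable_completion) simp

lemma gamma_weight_measurable [measurable]:
  "(\<lambda>u. exp (- u) * u powr \<alpha> :: real) \<in> borel_measurable (lebesgue_on {0<..})"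
  by (rule borel_imp_lebesgue_on) measurable

lemma
  assumes f: "f \<in> borel_measurable (lebesgue_on {0<..})"
  shows integrable_gamma_measure: "integrable (gamma_measure \<alpha>) f \<longleftrightarrow>
      integrable lebesgue (\<lambda>u. indicator {0<..} u * (exp (- u) * u powr \<alpha> * f u :: real))"
    and integral_gamma_measure: "integral\<^sup>L (gamma_measure \<alpha>) f =
      integral\<^sup>L lebesgue (\<lambda>u. indicator {0<..} u * (exp (- u) * u powr \<alpha> * f u :: real))"
proof -
  have "integrable (gamma_measure \<alpha>) f \<longleftrightarrow> integrable (lebesgue_on {0<..}) (\<lambda>u. (exp (- u) * u powr \<alpha>) *\<^sub>R f u)"
    unfolding gamma_measure_def by (rule integrable_density[OF f]) auto
  then show "integrable (gamma_measure \<alpha>) f \<longleftrightarrow>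
      integrable lebesgue (\<lambda>u. indicator {0<..} u * (exp (- u) * u powr \<alpha> * f u :: real))"
    by (simp add: integrable_restrict_space)
  have "integral\<^sup>L (gamma_measure \<alpha>) f = integral\<^sup>L (lebesgue_on {0<..}) (\<lambda>u. (exp (- u) * u powr \<alpha>) *\<^sub>R f u)"
    unfolding gamma_measure_def by (rule integral_density[OF f]) auto
  then show "integral\<^sup>L (gamma_measure \<alpha>) f =
      integral\<^sup>L lebesgue (\<lambda>u. indicator {0<..} u * (exp (- u) * u powr \<alpha> * f u :: real))"
    by (simp add: integral_restrict_space)
qed

lemma integrable_powr_gamma_measure:
  assumes "\<alpha> + p > -1"
  shows "integrable (gamma_measure \<alpha>) (\<lambda>u. u powr p)"
proof -
  have "((\<lambda>t. t powr (\<alpha> + p + 1 - 1) / exp t) has_integral Gamma (\<alpha> + p + 1)) {0..}"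
    using assms by (intro Gamma_integral_real) auto
  then have "(\<lambda>t. t powr (\<alpha> + p) / exp t) absolutely_integrable_on {0..}"
    by (intro nonnegative_absolutely_integrable_1) (auto simp: has_integral_integrable)
  then have "set_integrable lebesgue {0<..} (\<lambda>t. t powr (\<alpha> + p) / exp t)"
    by (rule set_integrable_subset) auto
  then have "integrable lebesgue (\<lambda>u. indicator {0<..} u * (exp (- u) * u powr \<alpha> * u powr p))"
    unfolding set_integrable_def
    by (rule Bochner_Integration.integrable_cong[THEN iffD1, rotated 2])
      (auto simp: exp_minus powr_add field_simps indicator_def)
  then show ?thesis
    by (subst integrable_gamma_measure) (auto intro: borel_imp_lebesgue_on)
qed

lemma finite_measure_gamma_measure:
  assumes "\<alpha> > -1"
  shows "finite_measure (gamma_measure \<alpha>)"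
proof
  have "integrable (gamma_measure \<alpha>) (\<lambda>u. u powr 0)"
    using assms by (intro integrable_powr_gamma_measure) auto
  then have "integrable (gamma_measure \<alpha>) (indicator {0<..} :: real \<Rightarrow> real)"
    by (rule Bochner_Integration.integrable_cong[THEN iffD1, rotated 2]) (auto simp: indicator_def)
  then show "emeasure (gamma_measure \<alpha>) (space (gamma_measure \<alpha>)) \<noteq> \<infinity>"
    by (simp add: integrable_indicator_iff less_top)
qed

lemma measure_gamma_measure_pos:
  assumes "\<alpha> > -1" "0 \<le> a" "a < b"
  shows "measure (gamma_measure \<alpha>) {a<..<b} > 0"
proof -
  interpret finite_measure "gamma_measure \<alpha>" using assms by (intro finite_measure_gamma_measure)
  have sub: "{a<..<b} \<in> sets (lebesgue_on {0<..})"
    using assms by (subst sets_restrict_space_iff) auto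
  have "emeasure (gamma_measure \<alpha>) {a<..<b} \<noteq> 0"
  proof
    assume "emeasure (gamma_measure \<alpha>) {a<..<b} = 0"
    then have "{a<..<b} \<in> null_sets (gamma_measure \<alpha>)"
      using sub by (simp add: null_sets_def sets_gamma_measure)
    then have "AE x in lebesgue_on {0<..}. x \<in> {a<..<b} \<longrightarrow> ennreal (exp (- x) * x powr \<alpha>) = 0"
      unfolding gamma_measure_def by (subst (asm) null_sets_density_iff) auto
    then have "AE x in lebesgue_on {0<..}. x \<notin> {a<..<b}"
      by eventually_elim (use assms in \<open>auto simp: ennreal_eq_0_iff mult_le_0_iff\<close>)
    then have "{a<..<b} \<in> null_sets (lebesgue_on {0<..})"
      using sub by (subst (asm) AE_iff_null_sets[symmetric]) auto
    then have "{a<..<b} \<in> null_sets lebesgue"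
      by (subst (asm) null_sets_restrict_space) auto
    then have "emeasure lebesgue {a<..<b} = 0" by auto
    then show False using assms by simp
  qed
  then show ?thesis by (simp add: emeasure_eq_measure zero_less_measure_iff)
qed

lemma borel_measurable_gamma_measure_iff:
  "f \<in> borel_measurable (gamma_measure \<alpha>) \<longleftrightarrow> f \<in> borel_measurable (lebesgue_on {0<..})"
  by (simp add: gamma_measure_def)

lemma integral_one_gamma_measure_pos:
  assumes "\<alpha> > -1"
  shows "(\<integral>u. 1 \<partial>gamma_measure \<alpha>) > (0::real)"
proof -
  interpret finite_measure "gamma_measure \<alpha>" using assms by (intro finite_measure_gamma_measure)
  have "measure (gamma_measure \<alpha>) {0<..<1} \<le> measure (gamma_measure \<alpha>) {0<..}"
    by (rule finite_measure_mono) (auto simp: sets_gamma_measure)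
  then show ?thesis using measure_gamma_measure_pos[OF assms, of 0 1] by simp
qed

lemma integrable_ln_gamma_measure:
  assumes "\<alpha> > -1"
  shows "integrable (gamma_measure \<alpha>) ln"
proof -
  \<comment> \<open>Half the margin \<open>\<alpha> + 1\<close>, so that \<open>\<alpha> - p\<close>
    stays above -1. The majorant comes from \<open>ln y \<le> y - 1\<close> at
    \<open>y = u powr p\<close> and \<open>y = u powr (- p)\<close>.\<close>
  define p where "p = (\<alpha> + 1) / 2"
  have p: "p > 0" "\<alpha> - p > -1" using assms by (auto simp: p_def field_simps)
  show ?thesis
  proof (rule Bochner_Integration.integrable_bound)
    show "integrable (gamma_measure \<alpha>) (\<lambda>u. (u powr p + u powr (- p)) / p)"
      using p assms by (intro integrable_divide Bochner_Integration.integrable_add integrable_powr_gamma_measure) auto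
    show "ln \<in> borel_measurable (gamma_measure \<alpha>)"
      by (simp add: borel_measurable_gamma_measure_iff borel_imp_lebesgue_on)
    show "AE u in gamma_measure \<alpha>. norm (ln u) \<le> norm ((u powr p + u powr (- p)) / p)"
    proof (rule AE_I2)
      fix u assume "u \<in> space (gamma_measure \<alpha>)"
      then have u: "u > 0" by simp
      have "p * ln u \<le> u powr p" "- p * ln u \<le> u powr (- p)"
        using u ln_le_minus_one[of "u powr p"] ln_le_minus_one[of "u powr (- p)"]
        by (auto simp: ln_powr)
      then have "p * \<bar>ln u\<bar> \<le> u powr p + u powr (- p)"
        using powr_ge_zero[of u p] powr_ge_zero[of u "- p"] abs_mult[of p "ln u"] p by linarith
      then show "norm (ln u) \<le> norm ((u powr p + u powr (- p)) / p)"
        using p by (simp add: field_simps)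
    qed
  qed
qed

section \<open>Changes of variables\<close>

text \<open>The extra factor turns the weight \<open>exp (- v)\<close> into
  \<open>exp (- c * v)\<close>, and \<open>u = c * v\<close> restores it. With
  \<open>c = j + 1\<close> this converts moments against powers of \<open>exp (- v)\<close> into
  values of the transform at \<open>s / (j + 1)\<close>.\<close>

lemma integral_exp_gamma_measure:
  assumes f: "f \<in> borel_measurable (lebesgue_on {0<..})" and "c > 0"
  shows "integral\<^sup>L (gamma_measure \<alpha>) (\<lambda>v. exp (- (c - 1) * v) * f v)
      = c powr (- \<alpha> - 1) * integral\<^sup>L (gamma_measure \<alpha>) (\<lambda>u. f (u / c))"
proof -
  define g where "g u = indicator {0<..} u * (exp (- u) * u powr \<alpha> * f (u / c))" for u :: real
  have f': "(\<lambda>u. f (u / c)) \<in> borel_measurable (lebesgue_on {0<..})"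
    using borel_measurable_lebesgue_on_scale[OF f, of "1 / c"] \<open>c > 0\<close> by simp
  have f'': "(\<lambda>v. exp (- (c - 1) * v) * f v) \<in> borel_measurable (lebesgue_on {0<..})"
    by (intro borel_measurable_times f borel_imp_lebesgue_on) measurable
  have g: "g (0 + c * x) = c powr \<alpha> * (indicator {0<..} x * (exp (- x) * x powr \<alpha> * (exp (- (c - 1) * x) * f x)))" for x
    using \<open>c > 0\<close> by (auto simp: g_def indicator_def zero_less_mult_iff powr_mult algebra_simps
        simp flip: exp_add)
  have "integral\<^sup>L (gamma_measure \<alpha>) (\<lambda>u. f (u / c)) = integral\<^sup>L lebesgue g"
    unfolding g_def by (rule integral_gamma_measure[OF f'])
  also have "\<dots> = c * integral\<^sup>L lebesgue (\<lambda>x. g (0 + c * x))"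
    using lebesgue_integral_real_affine[of c g 0] \<open>c > 0\<close> by simp
  also have "\<dots> = c * (c powr \<alpha> * integral\<^sup>L (gamma_measure \<alpha>) (\<lambda>v. exp (- (c - 1) * v) * f v))"
    unfolding g integral_gamma_measure[OF f''] by simp
  finally show "integral\<^sup>L (gamma_measure \<alpha>) (\<lambda>v. exp (- (c - 1) * v) * f v)
      = c powr (- \<alpha> - 1) * integral\<^sup>L (gamma_measure \<alpha>) (\<lambda>u. f (u / c))"
    using \<open>c > 0\<close> by (simp add: powr_diff powr_minus field_simps)
qed

text \<open>Substitution \<open>t = s * u\<close>. The equations also hold for divergent integrals,
  where both sides have the default value 0. The form in \<open>t\<close> is stated as well because
  for nonnegative \<open>F\<close> its integrand \<open>exp (- t / s) * F t\<close> increases with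
  \<open>s\<close>, while \<open>L (s * u)\<close> need not.\<close>

lemma
  assumes L: "L \<in> borel_measurable (lebesgue_on {0<..})" and "s > 0"
    and F: "\<And>t. t > 0 \<Longrightarrow> F t = t powr \<alpha> * L t"
  shows LS_transform_gamma_measure:
      "LS_transform F (1 / s) = s powr \<alpha> * integral\<^sup>L (gamma_measure \<alpha>) (\<lambda>u. L (s * u))"
    and LS_transform_eq_lebesgue_integral:
      "LS_transform F (1 / s) = (1 / s) * integral\<^sup>L lebesgue (\<lambda>t. indicator {0<..} t * (exp (- t / s) * F t))"
    and integrable_LS_gamma_measure:
      "integrable (gamma_measure \<alpha>) (\<lambda>u. L (s * u)) \<longleftrightarrow>
        integrable lebesgue (\<lambda>t. indicator {0<..} t * (exp (- t / s) * F t))"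
proof -
  define g where "g t = indicator {0<..} t * (1 / s * (exp (- t / s) * F t))" for t
  have L': "(\<lambda>u. L (s * u)) \<in> borel_measurable (lebesgue_on {0<..})"
    using borel_measurable_lebesgue_on_scale[OF L] \<open>s > 0\<close> by simp
  have g: "g (0 + s * u) = s powr \<alpha> / s * (indicator {0<..} u * (exp (- u) * u powr \<alpha> * L (s * u)))" for u
    using \<open>s > 0\<close> by (auto simp: g_def indicator_def zero_less_mult_iff powr_mult F)
  have g_meas: "g \<in> borel_measurable lebesgue"
  proof -
    have "(\<lambda>t. 1 / s * (exp (- t / s) * (t powr \<alpha> * L t))) \<in> borel_measurable (lebesgue_on {0<..})"
      by (intro borel_measurable_times L borel_imp_lebesgue_on) measurable
    then have "(\<lambda>t. indicator {0<..} t *\<^sub>R (1 / s * (exp (- t / s) * (t powr \<alpha> * L t)))) \<in> borel_measurable lebesgue"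
      by (subst (asm) borel_measurable_restrict_space_iff) auto
    also have "(\<lambda>t. indicator {0<..} t *\<^sub>R (1 / s * (exp (- t / s) * (t powr \<alpha> * L t)))) = g"
      by (auto simp: g_def fun_eq_iff indicator_def F)
    finally show ?thesis .
  qed
  have LS_eq: "LS_transform F (1 / s) = integral\<^sup>L lebesgue g"
  proof -
    \<comment> \<open>The transform integrates over a half-line that contains 0; the value of
      \<open>F\<close> there contributes only on a null set.\<close>
    have "LS_transform F (1 / s) = integral\<^sup>L lebesgue (\<lambda>t. g t + indicator {0} t * (F 0 / s))"
      unfolding LS_transform_def set_lebesgue_integral_def
      by (rule Bochner_Integration.integral_cong) (auto simp: g_def indicator_def)
    also have "\<dots> = integral\<^sup>L lebesgue g"
    proof (rule integral_cong_AE)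
      have "AE t in lebesgue. t \<noteq> (0::real)" by (rule AE_completion[OF AE_lborel_singleton])
      then show "AE t in lebesgue. g t + indicator {0} t * (F 0 / s) = g t"
        by eventually_elim auto
      show "(\<lambda>t. g t + indicator {0} t * (F 0 / s)) \<in> borel_measurable lebesgue"
        by (intro borel_measurable_add g_meas measurable_completion) simp
    qed (use g_meas in auto)
    finally show ?thesis .
  qed
  have g_mult: "g = (\<lambda>t. 1 / s * (indicator {0<..} t * (exp (- t / s) * F t)))"
    by (auto simp: g_def)
  show "LS_transform F (1 / s) = (1 / s) * integral\<^sup>L lebesgue (\<lambda>t. indicator {0<..} t * (exp (- t / s) * F t))"
    unfolding LS_eq g_mult by (rule integral_mult_right_zero)
  have "LS_transform F (1 / s) = integral\<^sup>L lebesgue g" by (rule LS_eq)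
  also have "\<dots> = s * integral\<^sup>L lebesgue (\<lambda>x. g (0 + s * x))"
    using lebesgue_integral_real_affine[of s g 0] \<open>s > 0\<close> by simp
  also have "\<dots> = s * (s powr \<alpha> / s * integral\<^sup>L (gamma_measure \<alpha>) (\<lambda>u. L (s * u)))"
    unfolding g by (subst integral_gamma_measure[OF L']) simp
  finally show "LS_transform F (1 / s) = s powr \<alpha> * integral\<^sup>L (gamma_measure \<alpha>) (\<lambda>u. L (s * u))"
    using \<open>s > 0\<close> by simp
  have "integrable (gamma_measure \<alpha>) (\<lambda>u. L (s * u)) \<longleftrightarrow> integrable lebesgue (\<lambda>x. g (0 + s * x))"
    unfolding g using \<open>s > 0\<close>
    by (simp only: integrable_gamma_measure[OF L'] integrable_mult_left_iff) simp
  also have "\<dots> \<longleftrightarrow> integrable lebesgue g"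
    using \<open>s > 0\<close> by (intro lebesgue_integrable_real_affine_iff) auto
  also have "\<dots> \<longleftrightarrow> integrable lebesgue (\<lambda>t. indicator {0<..} t * (exp (- t / s) * F t))"
    unfolding g_mult using \<open>s > 0\<close> by (subst integrable_mult_left_iff) simp
  finally show "integrable (gamma_measure \<alpha>) (\<lambda>u. L (s * u)) \<longleftrightarrow>
        integrable lebesgue (\<lambda>t. indicator {0<..} t * (exp (- t / s) * F t))" .
qed

section \<open>The Abelian theorem\<close>

text \<open>The difference lives where \<open>s * u < T\<close>. Bounding \<open>exp (- u)\<close>
  by 1 and substituting \<open>t = s * u\<close> leaves \<open>s powr (- \<alpha> - 1)\<close> times
  a fixed integral over \<open>(0, T)\<close>, finite because \<open>t powr \<alpha> * L t\<close>
  is bounded there and \<open>\<alpha> > -1\<close>.\<close>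

lemma cutoff_error:
  fixes L :: "real \<Rightarrow> real"
  assumes L: "L \<in> borel_measurable (lebesgue_on {0<..})" and "\<alpha> > -1" and "T > 0"
    and bound: "\<And>t. 0 < t \<Longrightarrow> t < T \<Longrightarrow> \<bar>t powr \<alpha> * L t\<bar> \<le> M"
  obtains C where "C \<ge> 0"
    "\<And>s. s > 0 \<Longrightarrow> integrable (gamma_measure \<alpha>) (\<lambda>u. L (s * u) - L (max (s * u) T))"
    "\<And>s. s > 0 \<Longrightarrow> \<bar>\<integral>u. L (s * u) - L (max (s * u) T) \<partial>gamma_measure \<alpha>\<bar> \<le> C * s powr (- \<alpha> - 1)"
proof -
  define h where "h t = L t - L (max t T)" for t
  define q where "q t = indicator {0<..} t * (t powr \<alpha> * h t)" for t
  have h0: "h t = 0" if "t \<ge> T" for t using that by (simp add: h_def max_def)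
  have h1: "h t = L t - L T" if "t < T" for t using that by (simp add: h_def max_def)
  have h_eq: "h t = indicator {..<T} t * (L t - L T)" for t using h0 h1 by (cases "t < T") auto
  have h_meas: "h \<in> borel_measurable (lebesgue_on {0<..})"
    unfolding h_eq by (intro borel_measurable_times borel_measurable_diff L borel_imp_lebesgue_on) auto
  have q_meas: "q \<in> borel_measurable lebesgue"
  proof -
    have "(\<lambda>t. t powr \<alpha> * h t) \<in> borel_measurable (lebesgue_on {0<..})"
      by (intro borel_measurable_times h_meas borel_imp_lebesgue_on) measurable
    then show ?thesis unfolding q_def
      by (subst (asm) borel_measurable_restrict_space_iff) auto
  qed
  have q_int: "integrable lebesgue q"
  proof (rule Bochner_Integration.integrable_bound[OF _ q_meas])
    \<comment> \<open>On \<open>(0, T)\<close> the factor \<open>exp (T - t)\<close> is at least 1,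
      so Gamma weights with exponents \<open>\<alpha>\<close> and 0 dominate the part coming from
      \<open>L T\<close> and the bounded part.\<close>
    have "integrable lebesgue (\<lambda>u. indicator {0<..} u * (exp (- u) * u powr \<alpha> * u powr 0) :: real)"
      "integrable lebesgue (\<lambda>u. indicator {0<..} u * (exp (- u) * u powr 0 * u powr 0) :: real)"
      using integrable_powr_gamma_measure[of \<alpha> 0] integrable_powr_gamma_measure[of 0 0] \<open>\<alpha> > -1\<close>
      by (simp_all add: integrable_gamma_measure borel_imp_lebesgue_on)
    then show "integrable lebesgue (\<lambda>u. exp T * (\<bar>L T\<bar> * (indicator {0<..} u * (exp (- u) * u powr \<alpha> * u powr 0))
        + \<bar>M\<bar> * (indicator {0<..} u * (exp (- u) * u powr 0 * u powr 0))))"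
      by (intro integrable_mult_right Bochner_Integration.integrable_add)
    show "AE t in lebesgue. norm (q t) \<le> norm (exp T * (\<bar>L T\<bar> * (indicator {0<..} t * (exp (- t) * t powr \<alpha> * t powr 0))
        + \<bar>M\<bar> * (indicator {0<..} t * (exp (- t) * t powr 0 * t powr 0))))"
    proof (rule AE_I2)
      fix t :: real
      show "norm (q t) \<le> norm (exp T * (\<bar>L T\<bar> * (indicator {0<..} t * (exp (- t) * t powr \<alpha> * t powr 0))
        + \<bar>M\<bar> * (indicator {0<..} t * (exp (- t) * t powr 0 * t powr 0))))"
      proof (cases "0 < t \<and> t < T")
        case True
        have "\<bar>q t\<bar> = \<bar>t powr \<alpha> * L t - t powr \<alpha> * L T\<bar>"
          using True by (simp add: q_def h1 algebra_simps)
        also have "\<dots> \<le> \<bar>L T\<bar> * t powr \<alpha> + \<bar>M\<bar>"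
          using bound[of t] True abs_mult[of "t powr \<alpha>" "L T"] by (simp add: mult.commute)
        also have "\<dots> \<le> exp (T - t) * (\<bar>L T\<bar> * t powr \<alpha> + \<bar>M\<bar>)"
          using True mult_right_mono[of 1 "exp (T - t)" "\<bar>L T\<bar> * t powr \<alpha> + \<bar>M\<bar>"] by simp
        also have "\<dots> = exp T * (\<bar>L T\<bar> * (exp (- t) * t powr \<alpha>) + \<bar>M\<bar> * exp (- t))"
          by (simp add: exp_diff exp_minus field_simps)
        finally show ?thesis using True by (simp add: indicator_def)
      next
        case False
        then have "q t = 0" using h0 by (auto simp: q_def indicator_def)
        then show ?thesis by simp
      qed
    qed
  qed
  have q_scaled: "integrable lebesgue (\<lambda>u. s powr (- \<alpha>) * \<bar>q (s * u)\<bar>)" if "s > 0" for s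
    using lebesgue_integrable_real_affine[OF integrable_abs[OF q_int], of s 0] that by simp
  have h_scaled: "(\<lambda>u. h (s * u)) \<in> borel_measurable (lebesgue_on {0<..})" if "s > 0" for s
    using borel_measurable_lebesgue_on_scale[OF h_meas] that by simp
  have dom: "\<bar>indicator {0<..} u * (exp (- u) * u powr \<alpha> * h (s * u))\<bar> \<le> s powr (- \<alpha>) * \<bar>q (s * u)\<bar>"
    if "s > 0" for s u :: real
  proof (cases "u > 0")
    case True
    have "s powr (- \<alpha>) * \<bar>q (s * u)\<bar> = u powr \<alpha> * \<bar>h (s * u)\<bar>"
      using True that by (simp add: q_def abs_mult powr_mult powr_minus field_simps)
    then show ?thesis
      using True mult_right_mono[of "exp (- u)" 1 "u powr \<alpha> * \<bar>h (s * u)\<bar>"]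
      by (simp add: abs_mult mult.assoc)
  qed auto
  have h_int: "integrable (gamma_measure \<alpha>) (\<lambda>u. h (s * u))" if "s > 0" for s
    unfolding integrable_gamma_measure[OF h_scaled[OF that]]
  proof (rule Bochner_Integration.integrable_bound[OF q_scaled[OF that]])
    show "(\<lambda>u. indicator {0<..} u * (exp (- u) * u powr \<alpha> * h (s * u))) \<in> borel_measurable lebesgue"
    proof -
      have "(\<lambda>u. exp (- u) * u powr \<alpha> * h (s * u)) \<in> borel_measurable (lebesgue_on {0<..})"
        by (intro borel_measurable_times[OF gamma_weight_measurable h_scaled[OF that]])
      then show ?thesis
        by (subst (asm) borel_measurable_restrict_space_iff) auto
    qed
  qed (use dom[OF that] in auto)
  show ?thesis
  proof (rule that[of "integral\<^sup>L lebesgue (\<lambda>t. \<bar>q t\<bar>)"])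
    fix s :: real assume s: "s > 0"
    show "integrable (gamma_measure \<alpha>) (\<lambda>u. L (s * u) - L (max (s * u) T))"
      using h_int[OF s] by (simp add: h_def)
    have "\<bar>integral\<^sup>L (gamma_measure \<alpha>) (\<lambda>u. h (s * u))\<bar>
        \<le> integral\<^sup>L lebesgue (\<lambda>u. \<bar>indicator {0<..} u * (exp (- u) * u powr \<alpha> * h (s * u))\<bar>)"
      unfolding integral_gamma_measure[OF h_scaled[OF s]] by (rule integral_abs_bound)
    also have "\<dots> \<le> integral\<^sup>L lebesgue (\<lambda>u. s powr (- \<alpha>) * \<bar>q (s * u)\<bar>)"
      using h_int[OF s] dom[OF s] q_scaled[OF s]
      unfolding integrable_gamma_measure[OF h_scaled[OF s]]
      by (intro integral_mono integrable_abs)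
    also have "\<dots> = s powr (- \<alpha>) * (integral\<^sup>L lebesgue (\<lambda>t. \<bar>q t\<bar>) / s)"
      using lebesgue_integral_real_affine[of s "\<lambda>t. \<bar>q t\<bar>" 0] s by simp
    also have "\<dots> = integral\<^sup>L lebesgue (\<lambda>t. \<bar>q t\<bar>) * s powr (- \<alpha> - 1)"
      using s by (simp add: powr_diff)
    finally show "\<bar>\<integral>u. L (s * u) - L (max (s * u) T) \<partial>gamma_measure \<alpha>\<bar>
        \<le> integral\<^sup>L lebesgue (\<lambda>t. \<bar>q t\<bar>) * s powr (- \<alpha> - 1)" by (simp add: h_def)
  qed simp
qed

context second_order_slow
begin

lemma cutoff_error_negligible:
  assumes "\<And>s. s > 0 \<Longrightarrow> \<bar>e s\<bar> \<le> C * s powr (- \<alpha> - 1)" "\<alpha> > -1"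
  shows "((\<lambda>s. e s / L s / A s) \<longlongrightarrow> 0) at_top"
proof (rule Lim_null_comparison)
  have "filterlim (\<lambda>t. t powr (\<alpha> + 1) * (\<bar>A t\<bar> * L t)) at_top at_top"
    using assms by (intro power_times_A_L_at_top) auto
  then have "((\<lambda>t. inverse (t powr (\<alpha> + 1) * (\<bar>A t\<bar> * L t))) \<longlongrightarrow> 0) at_top"
    by (rule tendsto_inverse_0_at_top)
  then show "((\<lambda>t. C * inverse (t powr (\<alpha> + 1) * (\<bar>A t\<bar> * L t))) \<longlongrightarrow> 0) at_top"
    by (rule tendsto_mult_right_zero)
  show "\<forall>\<^sub>F s in at_top. norm (e s / L s / A s) \<le> C * inverse (s powr (\<alpha> + 1) * (\<bar>A s\<bar> * L s))"
    using L_pos A_nonzero eventually_gt_at_top[of 0]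
  proof eventually_elim
    case (elim s)
    have "norm (e s / L s / A s) = \<bar>e s\<bar> / (\<bar>A s\<bar> * L s)"
      using elim by (simp add: abs_mult mult.commute)
    also have "\<dots> \<le> C * s powr (- \<alpha> - 1) / (\<bar>A s\<bar> * L s)"
      using elim assms by (intro divide_right_mono) auto
    also have "s powr (- \<alpha> - 1) = inverse (s powr (\<alpha> + 1))"
      by (simp add: powr_minus[symmetric])
    finally show ?case by (simp add: field_simps)
  qed
qed

text \<open>Dominated convergence for second-order quotients. \<open>L\<close> is frozen below
  \<open>T\<close>, where the Potter-type bounds give no control, so that one majorant serves all
  \<open>s \<ge> T\<close>; the cutoff estimate then undoes the freezing.\<close>

theorem abelian:
  assumes "\<alpha> > -1"
    and loc: "\<And>T. \<exists>M. \<forall>t. 0 < t \<and> t < T \<longrightarrow> \<bar>t powr \<alpha> * L t\<bar> \<le> M"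
  shows "\<forall>\<^sub>F s in at_top. integrable (gamma_measure \<alpha>) (\<lambda>u. L (s * u))"
    and "((\<lambda>s. ((\<integral>u. L (s * u) \<partial>gamma_measure \<alpha>) / L s - (\<integral>u. 1 \<partial>gamma_measure \<alpha>)) / A s)
      \<longlongrightarrow> (\<integral>u. ln u \<partial>gamma_measure \<alpha>)) at_top"
proof -
  interpret finite_measure "gamma_measure \<alpha>" using assms by (intro finite_measure_gamma_measure)
  \<comment> \<open>A quarter of the margin \<open>\<alpha> + 1\<close>: the majorant behaves like
    \<open>u powr (- 2 * p)\<close> near 0, because two Potter-type bounds are chained
    there.\<close>
  define p where "p = (\<alpha> + 1) / 4"
  have p: "p > 0" "\<alpha> - 2 * p > -1" "\<alpha> + p > -1" using assms by (auto simp: p_def field_simps)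
  obtain T K where TK: "T > 0" "K > 0" "\<And>t. t \<ge> T \<Longrightarrow> A t \<noteq> 0 \<and> L t > 0"
    "\<And>t u. t \<ge> T \<Longrightarrow> u \<ge> 1 \<Longrightarrow> \<bar>A t\<bar> * L t \<le> K * u powr p * (\<bar>A (t * u)\<bar> * L (t * u))"
    "\<And>t u. t \<ge> T \<Longrightarrow> u \<ge> 1 \<Longrightarrow> \<bar>L (t * u) - L t\<bar> \<le> K * u powr p * (\<bar>A t\<bar> * L t)"
    by (rule potter_bounds[OF \<open>p > 0\<close>]) blast
  define w where "w u = (K + K * K) * (u powr p + u powr (- 2 * p))" for u
  have w_int: "integrable (gamma_measure \<alpha>) w"
    unfolding w_def using p
    by (intro integrable_mult_right Bochner_Integration.integrable_add integrable_powr_gamma_measure) auto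
  define D where "D s u = (L (max (s * u) T) / L s - 1) / A s" for s u
  have D_bound: "\<bar>D s u\<bar> \<le> w u" if "s \<ge> T" "u > 0" for s u
  proof -
    have pos: "L s > 0" "A s \<noteq> 0" using TK(3) that by auto
    have "\<bar>L (max (s * u) T) - L s\<bar> \<le> w u * (\<bar>A s\<bar> * L s)"
    proof (cases "u \<ge> 1")
      case True
      then have "max (s * u) T = s * u" using that TK(1) mult_mono[of T s 1 u] by simp
      then have "\<bar>L (max (s * u) T) - L s\<bar> \<le> K * u powr p * (\<bar>A s\<bar> * L s)"
        using TK(5)[of s u] that True by simp
      also have "\<dots> \<le> w u * (\<bar>A s\<bar> * L s)"
        using pos TK(2) unfolding w_def by (intro mult_right_mono mult_mono) auto
      finally show ?thesis .
    next
      case False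
      \<comment> \<open>For \<open>u < 1\<close> the increment is read from the smaller argument
        \<open>s'\<close> up to \<open>s\<close>, and then the scale at \<open>s'\<close> is moved
        to \<open>s\<close>. Each of the two costs a factor \<open>v powr p\<close> with
        \<open>v \<le> 1 / u\<close>.\<close>
      define s' where "s' = max (s * u) T"
      define v where "v = s / s'"
      have s': "s' \<ge> T" "s' > 0" "s' \<le> s" using that False TK(1) by (auto simp: s'_def mult_le_cancel_left2)
      have v: "v \<ge> 1" "s' * v = s" using s' by (auto simp: v_def)
      have "v \<le> s / (s * u)" unfolding v_def using that TK(1) by (intro divide_left_mono) (auto simp: s'_def)
      then have "v \<le> 1 / u" using that TK(1) by simp
      then have "v powr p \<le> (1 / u) powr p" using v p by (intro powr_mono2) auto
      then have vp: "v powr p \<le> u powr (- p)" using that by (simp add: powr_divide powr_minus_divide)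
      have "\<bar>L s - L s'\<bar> \<le> K * v powr p * (\<bar>A s'\<bar> * L s')"
        using TK(5)[of s' v] s' v by simp
      also have "\<dots> \<le> K * v powr p * (K * v powr p * (\<bar>A s\<bar> * L s))"
        using TK(4)[of s' v] s' v TK(2) by (intro mult_left_mono) auto
      also have "\<dots> = K * K * (v powr p * v powr p) * (\<bar>A s\<bar> * L s)" by (simp only: mult_ac)
      also have "\<dots> \<le> K * K * (u powr (- p) * u powr (- p)) * (\<bar>A s\<bar> * L s)"
        using vp pos TK(2) by (intro mult_right_mono mult_left_mono mult_mono) auto
      also have "u powr (- p) * u powr (- p) = u powr (- 2 * p)"
        by (simp add: powr_add[symmetric])
      also have "K * K * u powr (- 2 * p) * (\<bar>A s\<bar> * L s) \<le> w u * (\<bar>A s\<bar> * L s)"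
        using pos TK(2) unfolding w_def by (intro mult_right_mono mult_mono) auto
      finally show ?thesis by (simp add: s'_def abs_minus_commute)
    qed
    moreover have "D s u = (L (max (s * u) T) - L s) / (A s * L s)"
      using pos by (simp add: D_def field_simps)
    ultimately show ?thesis using pos by (simp add: abs_mult divide_le_eq)
  qed
  have Lmax_meas: "(\<lambda>u. L (max (s * u) T)) \<in> borel_measurable (lebesgue_on {0<..})" if "s > 0" for s
  proof -
    have "(\<lambda>u. if s * u < T then L T else L (s * u)) \<in> borel_measurable (lebesgue_on {0<..})"
    proof (rule measurable_If)
      have "(\<lambda>u. s * u) \<in> borel_measurable (lebesgue_on {0<..})"
        by (rule borel_imp_lebesgue_on) simp
      then show "{u \<in> space (lebesgue_on {0<..}). s * u < T} \<in> sets (lebesgue_on {0<..})" by measurable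
    qed (use borel_measurable_lebesgue_on_scale[OF L_measurable that] in auto)
    then show ?thesis
      by (rule measurable_cong[THEN iffD1, rotated]) (auto simp: max_def)
  qed
  have D_meas: "D s \<in> borel_measurable (gamma_measure \<alpha>)" if "s > 0" for s
    unfolding D_def borel_measurable_gamma_measure_iff
    by (intro borel_measurable_divide borel_measurable_diff Lmax_meas that borel_measurable_const)
  have D_int: "integrable (gamma_measure \<alpha>) (D s)" if "s \<ge> T" for s
  proof (rule Bochner_Integration.integrable_bound[OF w_int D_meas])
    show "AE u in gamma_measure \<alpha>. norm (D s u) \<le> norm (w u)"
      using D_bound[OF that] by (intro AE_I2) fastforce
  qed (use that TK(1) in auto)
  have D_lim: "((\<lambda>s. D s u) \<longlongrightarrow> ln u) at_top" if "u > 0" for u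
  proof -
    have "\<forall>\<^sub>F s in at_top. (L (s * u) / L s - 1) / A s = D s u"
      using eventually_at_top_scale[OF eventually_ge_at_top[of T] that]
      by eventually_elim (simp add: D_def max_def)
    with L_second_order[OF that] show ?thesis by (rule Lim_transform_eventually)
  qed
  have Lmax_eq: "L (max (s * u) T) = L s + (L s * A s) * D s u" if "s \<ge> T" for s u
    using TK(3)[OF that] by (simp add: D_def field_simps)
  have Lmax_int: "\<forall>\<^sub>F s in at_top. integrable (gamma_measure \<alpha>) (\<lambda>u. L (max (s * u) T))"
    using eventually_ge_at_top[of T]
  proof eventually_elim
    case (elim s)
    show ?case unfolding Lmax_eq[OF elim] using D_int[OF elim] by auto
  qed
  \<comment> \<open>The convergence rule asks for measurability at every real parameter, while
    \<open>D s\<close> is known to be measurable for positive \<open>s\<close>;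
    \<open>max s T\<close> repairs this without changing anything near infinity.\<close>
  have "((\<lambda>s. integral\<^sup>L (gamma_measure \<alpha>) (D (max s T))) \<longlongrightarrow> integral\<^sup>L (gamma_measure \<alpha>) ln) at_top"
  proof (rule integral_dominated_convergence_at_top[where w = w])
    show "AE u in gamma_measure \<alpha>. ((\<lambda>s. D (max s T) u) \<longlongrightarrow> ln u) at_top"
    proof (rule AE_I2)
      fix u assume "u \<in> space (gamma_measure \<alpha>)"
      then have "((\<lambda>s. D s u) \<longlongrightarrow> ln u) at_top" using D_lim by simp
      moreover have "\<forall>\<^sub>F s in at_top. D s u = D (max s T) u"
        using eventually_ge_at_top[of T] by eventually_elim (simp add: max_def)
      ultimately show "((\<lambda>s. D (max s T) u) \<longlongrightarrow> ln u) at_top" by (rule Lim_transform_eventually)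
    qed
    show "\<forall>\<^sub>F s in at_top. AE u in gamma_measure \<alpha>. norm (D (max s T) u) \<le> w u"
      using D_bound by (intro always_eventually allI AE_I2) auto
    show "D (max s T) \<in> borel_measurable (gamma_measure \<alpha>)" for s
      using TK(1) by (intro D_meas) auto
  qed (use w_int in \<open>auto simp: borel_measurable_gamma_measure_iff borel_imp_lebesgue_on\<close>)
  moreover have "\<forall>\<^sub>F s in at_top. integral\<^sup>L (gamma_measure \<alpha>) (D (max s T))
      = ((\<integral>u. L (max (s * u) T) \<partial>gamma_measure \<alpha>) / L s - (\<integral>u. 1 \<partial>gamma_measure \<alpha>)) / A s"
    using eventually_ge_at_top[of T]
  proof eventually_elim
    case (elim s)
    then have pos: "L s > 0" "A s \<noteq> 0" using TK(3) by auto
    have "(\<integral>u. L (max (s * u) T) \<partial>gamma_measure \<alpha>)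
        = (\<integral>u. L s \<partial>gamma_measure \<alpha>) + (\<integral>u. (L s * A s) * D s u \<partial>gamma_measure \<alpha>)"
      unfolding Lmax_eq[OF elim] using D_int[OF elim]
      by (intro Bochner_Integration.integral_add) auto
    then show ?case using pos elim by (simp add: max_def field_simps)
  qed
  ultimately have lim1: "((\<lambda>s. ((\<integral>u. L (max (s * u) T) \<partial>gamma_measure \<alpha>) / L s - (\<integral>u. 1 \<partial>gamma_measure \<alpha>)) / A s)
      \<longlongrightarrow> (\<integral>u. ln u \<partial>gamma_measure \<alpha>)) at_top"
    by (rule Lim_transform_eventually)
  obtain M where M: "\<And>t. 0 < t \<Longrightarrow> t < T \<Longrightarrow> \<bar>t powr \<alpha> * L t\<bar> \<le> M" using loc[of T] by blast
  obtain C where C: "\<And>s. s > 0 \<Longrightarrow> integrable (gamma_measure \<alpha>) (\<lambda>u. L (s * u) - L (max (s * u) T))"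
    "\<And>s. s > 0 \<Longrightarrow> \<bar>\<integral>u. L (s * u) - L (max (s * u) T) \<partial>gamma_measure \<alpha>\<bar> \<le> C * s powr (- \<alpha> - 1)"
    by (rule cutoff_error[OF L_measurable \<open>\<alpha> > -1\<close> \<open>T > 0\<close> M]) blast+
  have lim2: "((\<lambda>s. (\<integral>u. L (s * u) - L (max (s * u) T) \<partial>gamma_measure \<alpha>) / L s / A s) \<longlongrightarrow> 0) at_top"
    by (rule cutoff_error_negligible[OF C(2) \<open>\<alpha> > -1\<close>])
  have int: "\<forall>\<^sub>F s in at_top. integrable (gamma_measure \<alpha>) (\<lambda>u. L (s * u)) \<and>
     (\<integral>u. L (s * u) \<partial>gamma_measure \<alpha>) = (\<integral>u. L (max (s * u) T) \<partial>gamma_measure \<alpha>)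
        + (\<integral>u. L (s * u) - L (max (s * u) T) \<partial>gamma_measure \<alpha>)"
    using Lmax_int eventually_gt_at_top[of 0]
  proof eventually_elim
    case (elim s)
    then show ?case
      using Bochner_Integration.integrable_add[OF elim(1) C(1)[OF elim(2)]]
        Bochner_Integration.integral_add[OF elim(1) C(1)[OF elim(2)]] by simp
  qed
  then show "\<forall>\<^sub>F s in at_top. integrable (gamma_measure \<alpha>) (\<lambda>u. L (s * u))"
    by eventually_elim blast
  have "((\<lambda>s. ((\<integral>u. L (max (s * u) T) \<partial>gamma_measure \<alpha>) / L s - (\<integral>u. 1 \<partial>gamma_measure \<alpha>)) / A s
     + (\<integral>u. L (s * u) - L (max (s * u) T) \<partial>gamma_measure \<alpha>) / L s / A s)
      \<longlongrightarrow> (\<integral>u. ln u \<partial>gamma_measure \<alpha>) + 0) at_top"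
    by (intro tendsto_add lim1 lim2)
  moreover have "\<forall>\<^sub>F s in at_top. ((\<integral>u. L (max (s * u) T) \<partial>gamma_measure \<alpha>) / L s - (\<integral>u. 1 \<partial>gamma_measure \<alpha>)) / A s
     + (\<integral>u. L (s * u) - L (max (s * u) T) \<partial>gamma_measure \<alpha>) / L s / A s
     = ((\<integral>u. L (s * u) \<partial>gamma_measure \<alpha>) / L s - (\<integral>u. 1 \<partial>gamma_measure \<alpha>)) / A s"
    using int
  proof eventually_elim
    case (elim s)
    then have "(\<integral>u. L (s * u) \<partial>gamma_measure \<alpha>) = (\<integral>u. L (max (s * u) T) \<partial>gamma_measure \<alpha>)
        + (\<integral>u. L (s * u) - L (max (s * u) T) \<partial>gamma_measure \<alpha>)" by blast
    then show ?case by (simp only: add_divide_distrib diff_divide_distrib)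
  qed
  ultimately show "((\<lambda>s. ((\<integral>u. L (s * u) \<partial>gamma_measure \<alpha>) / L s - (\<integral>u. 1 \<partial>gamma_measure \<alpha>)) / A s)
      \<longlongrightarrow> (\<integral>u. ln u \<partial>gamma_measure \<alpha>)) at_top"
    by (simp add: Lim_transform_eventually)
qed

end

section \<open>The Tauberian theorem\<close>

lemma integrable_comp_exp_gamma_measure:
  fixes f g :: "real \<Rightarrow> real"
  assumes f: "continuous_on UNIV f" and g: "integrable (gamma_measure \<alpha>) g"
  shows "integrable (gamma_measure \<alpha>) (\<lambda>v. f (exp (- v)) * g v)"
proof -
  have "bounded (f ` {0..1})"
    by (intro compact_imp_bounded compact_continuous_image continuous_on_subset[OF f]) auto
  then obtain B where B: "\<And>x. x \<in> {0..1} \<Longrightarrow> \<bar>f x\<bar> \<le> B"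
    unfolding bounded_iff by (metis imageI real_norm_def)
  have "(\<lambda>v. f (exp (- v))) \<in> borel_measurable borel"
    by (intro borel_measurable_continuous_onI continuous_on_compose2[OF f]) (auto intro!: continuous_intros)
  then have [measurable]: "(\<lambda>v. f (exp (- v))) \<in> borel_measurable (gamma_measure \<alpha>)"
    unfolding borel_measurable_gamma_measure_iff by (rule borel_imp_lebesgue_on)
  show ?thesis
  proof (rule Bochner_Integration.integrable_bound)
    show "integrable (gamma_measure \<alpha>) (\<lambda>v. B * g v)" using g by simp
    show "(\<lambda>v. f (exp (- v)) * g v) \<in> borel_measurable (gamma_measure \<alpha>)"
      using g by measurable
    show "AE v in gamma_measure \<alpha>. norm (f (exp (- v)) * g v) \<le> norm (B * g v)"
    proof (rule AE_I2)
      fix v assume "v \<in> space (gamma_measure \<alpha>)"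
      then have "\<bar>f (exp (- v))\<bar> \<le> \<bar>B\<bar>" using B[of "exp (- v)"] by fastforce
      then show "norm (f (exp (- v)) * g v) \<le> norm (B * g v)"
        by (auto simp: abs_mult intro: mult_right_mono)
    qed
  qed
qed

text \<open>A continuous substitute for the indicator of an interval. As a function of
  \<open>exp (- v)\<close> it is within reach of polynomial approximation on \<open>[0, 1]\<close>;
  it is the positive part of a parabola with zeros \<open>exp (- b)\<close> and
  \<open>exp (- a)\<close>.\<close>

lemma gamma_measure_bump:
  assumes "\<alpha> > -1" "0 \<le> a" "a < b"
  shows "\<exists>f :: real \<Rightarrow> real. continuous_on UNIV f \<and> (\<forall>x. f x \<ge> 0) \<and> (\<forall>v. v \<notin> {a<..<b} \<longrightarrow> f (exp (- v)) = 0)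
    \<and> (\<integral>v. f (exp (- v)) \<partial>gamma_measure \<alpha>) > 0"
proof -
  interpret finite_measure "gamma_measure \<alpha>" using assms by (intro finite_measure_gamma_measure)
  define f where "f x = max 0 ((exp (- a) - x) * (x - exp (- b)))" for x :: real
  have cont: "continuous_on UNIV f" unfolding f_def by (intro continuous_intros)
  have nonneg: "f x \<ge> 0" for x by (simp add: f_def)
  have zero: "f (exp (- v)) = 0" if v: "v \<notin> {a<..<b}" for v
  proof -
    consider "v \<le> a" | "b \<le> v" using v by fastforce
    then have "(exp (- a) - exp (- v)) * (exp (- v) - exp (- b)) \<le> 0"
    proof cases
      case 1
      then show ?thesis using \<open>a < b\<close> by (intro mult_nonpos_nonneg) auto
    next
      case 2
      then show ?thesis using \<open>a < b\<close> by (intro mult_nonneg_nonpos) auto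
    qed
    then show ?thesis by (simp add: f_def)
  qed
  have pos: "f (exp (- v)) > 0" if "v \<in> {a<..<b}" for v
    using that by (auto simp: f_def less_max_iff_disj intro!: mult_pos_pos)
  have int: "integrable (gamma_measure \<alpha>) (\<lambda>v. f (exp (- v)))"
    using integrable_comp_exp_gamma_measure[OF cont, of \<alpha> "\<lambda>_. 1"] by simp
  have "(\<integral>v. f (exp (- v)) \<partial>gamma_measure \<alpha>) \<noteq> 0"
  proof
    assume "(\<integral>v. f (exp (- v)) \<partial>gamma_measure \<alpha>) = 0"
    then have "AE v in gamma_measure \<alpha>. f (exp (- v)) = 0"
      using integral_nonneg_eq_0_iff_AE[OF int] nonneg by auto
    then have "AE v in gamma_measure \<alpha>. v \<notin> {a<..<b}"
      by eventually_elim (use pos in fastforce)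
    moreover have "{a<..<b} \<in> sets (gamma_measure \<alpha>)"
      unfolding sets_gamma_measure using assms by (subst sets_restrict_space_iff) auto
    ultimately have "emeasure (gamma_measure \<alpha>) {a<..<b} = 0"
      by (subst (asm) AE_iff_null_sets[symmetric]) auto
    then show False using measure_gamma_measure_pos[OF assms] by (simp add: measure_def)
  qed
  moreover have "(\<integral>v. f (exp (- v)) \<partial>gamma_measure \<alpha>) \<ge> 0"
    using nonneg by (intro Bochner_Integration.integral_nonneg)
  ultimately have "(\<integral>v. f (exp (- v)) \<partial>gamma_measure \<alpha>) > 0" by linarith
  with cont nonneg zero show ?thesis by (intro exI[of _ f]) simp
qed

text \<open>
  The kernel \<open>p v = 1 - exp (v0 - v)\<close> has integral \<open>0\<close> and changes sign only at \<open>v0\<close>, so for monotone \<open>D\<close>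
  the integral of \<open>p D\<close> equals that of \<open>\<bar>p\<bar> \<bar>D - D v0\<bar>\<close>.
\<close>

lemma tauberian_L1_bound:
  assumes "\<alpha> > -1"
  obtains K where "\<And>D B. mono_on {0<..} D \<Longrightarrow> integrable (gamma_measure \<alpha>) D \<Longrightarrow>
    \<bar>\<integral>v. D v \<partial>gamma_measure \<alpha>\<bar> \<le> B \<Longrightarrow> \<bar>\<integral>v. exp (- v) * D v \<partial>gamma_measure \<alpha>\<bar> \<le> B \<Longrightarrow>
    (\<integral>v. \<bar>D v\<bar> \<partial>gamma_measure \<alpha>) \<le> K * B"
proof -
  interpret finite_measure "gamma_measure \<alpha>" using assms by (intro finite_measure_gamma_measure)
  let ?M = "gamma_measure \<alpha>"
  \<comment> \<open>Chosen so that \<open>exp v0 = 2 powr (\<alpha> + 1)\<close>, the quotient of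
    the integrals of 1 and of \<open>exp (- v)\<close>; this makes the integral of \<open>p\<close>
    vanish.\<close>
  define v0 where "v0 = (\<alpha> + 1) * ln 2"
  have "v0 > 0" using assms by (simp add: v0_def)
  define p where "p v = 1 - exp (v0 - v)" for v
  define c where "c = measure ?M {0<..}"
  \<comment> \<open>\<open>\<delta>\<close> bounds \<open>\<bar>p\<bar>\<close> from below to the
    left of \<open>v0 / 2\<close> and to the right of \<open>2 * v0\<close>; \<open>\<mu>\<close>
    bounds from below the mass of one strip on each side.\<close>
  define \<delta> where "\<delta> = min (exp (v0 / 2) - 1) (1 - exp (- v0))"
  define \<mu> where "\<mu> = min (measure ?M {0<..<v0 / 2}) (measure ?M {2 * v0<..<2 * v0 + 1})"
  have "\<delta> > 0" using \<open>v0 > 0\<close> by (simp add: \<delta>_def)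
  have "\<mu> > 0" using measure_gamma_measure_pos[OF assms] \<open>v0 > 0\<close> by (simp add: \<mu>_def)
  have ev0: "exp v0 = 2 powr (\<alpha> + 1)" by (simp add: v0_def powr_def)
  have c: "(\<integral>v. 1 \<partial>?M) = c" by (simp add: c_def)
  have sets: "{a<..<b} \<in> sets ?M" if "a \<ge> 0" for a b :: real
    unfolding sets_gamma_measure using that by (subst sets_restrict_space_iff) auto
  have "measure ?M {0<..<1} \<le> c"
    unfolding c_def by (rule finite_measure_mono) (auto simp: sets_gamma_measure)
  then have "c > 0" using measure_gamma_measure_pos[OF assms, of 0 1] by simp
  have exp1: "(\<integral>v. exp (- v) * 1 \<partial>?M) = 2 powr (- \<alpha> - 1) * c"
    using integral_exp_gamma_measure[of "\<lambda>_. 1" 2 \<alpha>] c by simp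
  have exp_int: "integrable ?M (\<lambda>v. exp (- v) * g v)" if "integrable ?M g" for g
    using integrable_comp_exp_gamma_measure[of "\<lambda>x. x", OF _ that] by simp
  have p_eq: "p v * g = g - exp v0 * (exp (- v) * g)" for v g
    by (simp add: p_def exp_diff exp_minus field_simps)
  have p_int: "integrable ?M (\<lambda>v. p v * g v)"
    and p_integral: "(\<integral>v. p v * g v \<partial>?M) = (\<integral>v. g v \<partial>?M) - exp v0 * (\<integral>v. exp (- v) * g v \<partial>?M)"
    if "integrable ?M g" for g
    unfolding p_eq using that exp_int[OF that] by auto
  have p_zero: "(\<integral>v. p v * 1 \<partial>?M) = 0"
    using p_integral[of "\<lambda>_. 1"] exp1 by (simp add: c_def ev0 powr_add[symmetric] mult.assoc[symmetric])
  define N where "N = (1 + exp v0) / \<delta>"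
  define K1 where "K1 = N + c * (2 * N / \<mu>)"
  show ?thesis
  proof (rule that[of "2 * K1 + 1"])
    fix D :: "real \<Rightarrow> real" and B :: real
    assume mono: "mono_on {0<..} D" and D_int: "integrable ?M D"
      and B: "\<bar>\<integral>v. D v \<partial>?M\<bar> \<le> B" "\<bar>\<integral>v. exp (- v) * D v \<partial>?M\<bar> \<le> B"
    define E where "E v = D v - D v0" for v
    have E_int: "integrable ?M E" unfolding E_def using D_int by auto
    have E_mono: "E x \<le> E y" if "0 < x" "x \<le> y" for x y
      using mono_onD[OF mono, of x y] that by (auto simp: E_def)
    have "E v0 = 0" by (simp add: E_def)
    have pE_nonneg: "p v * E v \<ge> 0" if "v > 0" for v
    proof (cases "v \<le> v0")
      case True
      then have "E v \<le> 0" "p v \<le> 0" using E_mono[of v v0] that \<open>E v0 = 0\<close> by (auto simp: p_def)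
      then show ?thesis by (rule mult_nonpos_nonpos[rotated])
    next
      case False
      then have "E v \<ge> 0" "p v \<ge> 0" using E_mono[of v0 v] \<open>v0 > 0\<close> \<open>E v0 = 0\<close> by (auto simp: p_def)
      then show ?thesis by simp
    qed
    have pE_int: "integrable ?M (\<lambda>v. p v * E v)" by (rule p_int[OF E_int])
    have "(\<integral>v. p v * E v \<partial>?M) = (\<integral>v. p v * D v \<partial>?M) - (\<integral>v. D v0 * (p v * 1) \<partial>?M)"
      unfolding E_def right_diff_distrib using p_int[OF D_int] p_int[of "\<lambda>_. 1"]
      by (subst Bochner_Integration.integral_diff[symmetric]) (auto simp: mult_ac)
    also have "\<dots> = (\<integral>v. D v \<partial>?M) - exp v0 * (\<integral>v. exp (- v) * D v \<partial>?M)"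
      using p_zero p_integral[OF D_int] by simp
    also have "\<dots> \<le> B + exp v0 * B"
    proof -
      have "- (exp v0 * (\<integral>v. exp (- v) * D v \<partial>?M)) \<le> exp v0 * B"
        using B(2) mult_left_mono[of "- (\<integral>v. exp (- v) * D v \<partial>?M)" B "exp v0"] by simp
      then show ?thesis using B(1) by linarith
    qed
    finally have pE: "(\<integral>v. p v * E v \<partial>?M) \<le> (1 + exp v0) * B" by (simp add: algebra_simps)
    have left: "\<delta> * - E v \<le> p v * E v" if "0 < v" "v \<le> v0 / 2" for v
    proof -
      have "exp (v0 / 2) \<le> exp (v0 - v)" using that by simp
      then have "p v \<le> - \<delta>" unfolding p_def \<delta>_def by linarith
      moreover have "E v \<le> 0" using E_mono[of v v0] that \<open>E v0 = 0\<close> by simp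
      ultimately show ?thesis using mult_right_mono_neg[of "p v" "- \<delta>" "E v"] by simp
    qed
    have right: "\<delta> * E v \<le> p v * E v" if "v \<ge> 2 * v0" for v
    proof -
      have "exp (v0 - v) \<le> exp (- v0)" using that by simp
      then have "\<delta> \<le> p v" unfolding p_def \<delta>_def by linarith
      moreover have "E v \<ge> 0" using E_mono[of v0 v] that \<open>v0 > 0\<close> \<open>E v0 = 0\<close> by simp
      ultimately show ?thesis by (rule mult_right_mono)
    qed
    \<comment> \<open>Turns the integral bound into pointwise ones. On each strip
      \<open>\<bar>E\<bar>\<close> is at least its value at the inner end, by monotonicity, so the
      mass of the strip bounds that value.\<close>
    have strip: "x * measure ?M {a<..<b} \<le> (1 + exp v0) * B"
      if "0 \<le> a" "\<And>v. v \<in> {a<..<b} \<Longrightarrow> x \<le> p v * E v" for a b x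
    proof -
      have "x * measure ?M {a<..<b} = (\<integral>v. x * indicator {a<..<b} v \<partial>?M)"
        using that(1) Int_absorb2[of "{a<..<b}" "{0<..}"] by fastforce
      also have "\<dots> \<le> (\<integral>v. p v * E v \<partial>?M)"
      proof (rule integral_mono[OF _ pE_int])
        show "integrable ?M (\<lambda>v. x * indicator {a<..<b} v)"
          using sets[OF that(1)] by (intro integrable_mult_right integrable_real_indicator) (auto simp: emeasure_eq_measure)
        fix v assume "v \<in> space ?M"
        then show "x * indicator {a<..<b} v \<le> p v * E v"
          using pE_nonneg[of v] that(2)[of v] by (cases "v \<in> {a<..<b}") auto
      qed
      finally show ?thesis using pE by linarith
    qed
    have "\<delta> * - E (v0 / 2) * measure ?M {0<..<v0 / 2} \<le> (1 + exp v0) * B"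
    proof (rule strip)
      fix v assume v: "v \<in> {0<..<v0 / 2}"
      then have "\<delta> * - E (v0 / 2) \<le> \<delta> * - E v"
        using E_mono[of v "v0 / 2"] \<open>\<delta> > 0\<close> by simp
      also have "\<dots> \<le> p v * E v" using left[of v] v by simp
      finally show "\<delta> * - E (v0 / 2) \<le> p v * E v" .
    qed simp
    moreover have E1: "- E (v0 / 2) \<ge> 0" "E (2 * v0) \<ge> 0"
      using E_mono[of "v0 / 2" v0] E_mono[of v0 "2 * v0"] \<open>v0 > 0\<close> \<open>E v0 = 0\<close> by auto
    have "\<delta> * - E (v0 / 2) * \<mu> \<le> \<delta> * - E (v0 / 2) * measure ?M {0<..<v0 / 2}"
      using \<open>\<delta> > 0\<close> E1(1) by (intro mult_left_mono mult_nonneg_nonneg) (auto simp: \<mu>_def)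
    ultimately have "\<delta> * - E (v0 / 2) * \<mu> \<le> (1 + exp v0) * B" by linarith
    then have M1: "- E (v0 / 2) \<le> N * B / \<mu>"
      using \<open>\<delta> > 0\<close> \<open>\<mu> > 0\<close> by (simp add: N_def field_simps)
    have "\<delta> * E (2 * v0) * measure ?M {2 * v0<..<2 * v0 + 1} \<le> (1 + exp v0) * B"
    proof (rule strip)
      fix v assume v: "v \<in> {2 * v0<..<2 * v0 + 1}"
      then have "\<delta> * E (2 * v0) \<le> \<delta> * E v"
        using E_mono[of "2 * v0" v] \<open>v0 > 0\<close> \<open>\<delta> > 0\<close> by simp
      also have "\<dots> \<le> p v * E v" using right[of v] v by simp
      finally show "\<delta> * E (2 * v0) \<le> p v * E v" .
    qed (use \<open>v0 > 0\<close> in simp)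
    moreover have "\<delta> * E (2 * v0) * \<mu> \<le> \<delta> * E (2 * v0) * measure ?M {2 * v0<..<2 * v0 + 1}"
      using \<open>\<delta> > 0\<close> E1(2) by (intro mult_left_mono mult_nonneg_nonneg) (auto simp: \<mu>_def)
    ultimately have "\<delta> * E (2 * v0) * \<mu> \<le> (1 + exp v0) * B" by linarith
    then have M2: "E (2 * v0) \<le> N * B / \<mu>"
      using \<open>\<delta> > 0\<close> \<open>\<mu> > 0\<close> by (simp add: N_def field_simps)
    \<comment> \<open>Away from \<open>v0\<close> the kernel controls \<open>E\<close> directly.
      Near \<open>v0\<close> the kernel vanishes, but monotonicity confines \<open>E\<close> between
      its values at \<open>v0 / 2\<close> and \<open>2 * v0\<close>, which are already
      bounded.\<close>
    have E_bound: "\<bar>E v\<bar> \<le> p v * E v / \<delta> + 2 * N * B / \<mu>" if "v > 0" for v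
    proof -
      have *: "p v * E v / \<delta> \<ge> 0" using pE_nonneg[OF that] \<open>\<delta> > 0\<close> by simp
      consider "v \<le> v0 / 2" | "v0 / 2 \<le> v" "v \<le> 2 * v0" | "2 * v0 \<le> v" by linarith
      then show ?thesis
      proof cases
        case 1
        then have "- E v \<le> p v * E v / \<delta>" using left[OF that] \<open>\<delta> > 0\<close> by (simp add: le_divide_eq mult.commute)
        moreover have "E v \<le> 0" using E_mono[of v v0] that 1 \<open>v0 > 0\<close> \<open>E v0 = 0\<close> by simp
        ultimately show ?thesis using M1 M2 E1 by linarith
      next
        case 2
        then have "E (v0 / 2) \<le> E v" "E v \<le> E (2 * v0)"
          using E_mono[of "v0 / 2" v] E_mono[of v "2 * v0"] that \<open>v0 > 0\<close> by auto
        then show ?thesis using M1 M2 E1 * by linarith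
      next
        case 3
        then have "E v \<le> p v * E v / \<delta>" using right[of v] \<open>\<delta> > 0\<close> by (simp add: le_divide_eq mult.commute)
        moreover have "E v \<ge> 0" using E_mono[of v0 v] 3 \<open>v0 > 0\<close> \<open>E v0 = 0\<close> by simp
        ultimately show ?thesis using M1 M2 E1 by linarith
      qed
    qed
    have "(\<integral>v. \<bar>E v\<bar> \<partial>?M) \<le> (\<integral>v. p v * E v / \<delta> + 2 * N * B / \<mu> \<partial>?M)"
      using E_bound E_int pE_int by (intro integral_mono) auto
    also have "\<dots> = (\<integral>v. p v * E v \<partial>?M) / \<delta> + c * (2 * N * B / \<mu>)"
      using pE_int by (simp add: c_def)
    also have "\<dots> \<le> (1 + exp v0) * B / \<delta> + c * (2 * N * B / \<mu>)"
      using pE \<open>\<delta> > 0\<close> by (intro add_right_mono divide_right_mono) auto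
    also have "\<dots> = K1 * B" by (simp add: K1_def N_def algebra_simps)
    finally have E_L1: "(\<integral>v. \<bar>E v\<bar> \<partial>?M) \<le> K1 * B" .
    \<comment> \<open>The subtracted constant \<open>D v0\<close> is recovered from the integral of
      \<open>E\<close>, since the integral of \<open>D\<close> is itself within
      \<open>B\<close>.\<close>
    have "(\<integral>v. E v \<partial>?M) = (\<integral>v. D v \<partial>?M) - c * D v0"
      unfolding E_def using D_int by (simp add: c_def)
    moreover have "\<bar>\<integral>v. E v \<partial>?M\<bar> \<le> (\<integral>v. \<bar>E v\<bar> \<partial>?M)" by (rule integral_abs_bound)
    ultimately have "\<bar>c * D v0\<bar> \<le> B + K1 * B" using B(1) E_L1 by linarith
    then have v0_bound: "c * \<bar>D v0\<bar> \<le> B + K1 * B" using \<open>c > 0\<close> by (simp add: abs_mult)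
    have "(\<integral>v. \<bar>D v\<bar> \<partial>?M) \<le> (\<integral>v. \<bar>E v\<bar> + \<bar>D v0\<bar> \<partial>?M)"
      using D_int E_int by (intro integral_mono) (auto simp: E_def)
    also have "\<dots> = (\<integral>v. \<bar>E v\<bar> \<partial>?M) + c * \<bar>D v0\<bar>"
      using E_int by (simp add: c_def)
    also have "\<dots> \<le> (2 * K1 + 1) * B" using E_L1 v0_bound by (simp add: algebra_simps)
    finally show "(\<integral>v. \<bar>D v\<bar> \<partial>?M) \<le> (2 * K1 + 1) * B" .
  qed
qed

section \<open>From moments to pointwise limits\<close>

text \<open>Replacing \<open>f\<close> by a polynomial within \<open>\<eta>\<close> on
  \<open>[0, 1]\<close> changes each integral by at most \<open>\<eta>\<close> times an absolute
  integral, and \<open>B\<close> makes this error eventually uniform in \<open>s\<close>. For the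
  polynomial, the limit is a finite combination of moments.\<close>

lemma tauberian_test_functions:
  fixes D :: "real \<Rightarrow> real \<Rightarrow> real" and D\<^sub>0 f :: "real \<Rightarrow> real"
  assumes int: "\<forall>\<^sub>F s in F. integrable (gamma_measure \<alpha>) (D s)"
    and D\<^sub>0: "integrable (gamma_measure \<alpha>) D\<^sub>0"
    and L1: "\<forall>\<^sub>F s in F. (\<integral>v. \<bar>D s v\<bar> \<partial>gamma_measure \<alpha>) \<le> B"
    and lim: "\<And>j::nat. ((\<lambda>s. \<integral>v. exp (- v) ^ j * D s v \<partial>gamma_measure \<alpha>)
        \<longlongrightarrow> (\<integral>v. exp (- v) ^ j * D\<^sub>0 v \<partial>gamma_measure \<alpha>)) F"
    and f: "continuous_on UNIV f"
  shows "((\<lambda>s. \<integral>v. f (exp (- v)) * D s v \<partial>gamma_measure \<alpha>)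
    \<longlongrightarrow> (\<integral>v. f (exp (- v)) * D\<^sub>0 v \<partial>gamma_measure \<alpha>)) F"
proof (rule tendstoI)
  let ?M = "gamma_measure \<alpha>"
  fix e :: real assume "e > 0"
  define B0 where "B0 = (\<integral>v. \<bar>D\<^sub>0 v\<bar> \<partial>?M)"
  have "B0 \<ge> 0" unfolding B0_def by (intro Bochner_Integration.integral_nonneg) simp
  \<comment> \<open>\<open>\<bar>B\<bar> + B0\<close> covers both replacement errors; the summand 1
    keeps the divisor in \<open>\<eta>\<close> positive.\<close>
  define S where "S = \<bar>B\<bar> + B0 + 1"
  define \<eta> where "\<eta> = e / (2 * S)"
  have "S > 0" using \<open>B0 \<ge> 0\<close> by (simp add: S_def)
  then have "\<eta> > 0" using \<open>e > 0\<close> by (simp add: \<eta>_def)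
  obtain g where g: "real_polynomial_function g" "\<And>x. x \<in> {0..1} \<Longrightarrow> \<bar>f x - g x\<bar> < \<eta>"
    using Stone_Weierstrass_real_polynomial_function[of "{0..1}" f \<eta>] f \<open>\<eta> > 0\<close>
      continuous_on_subset[of UNIV f "{0..1}"] by auto
  then obtain a n where g_eq: "g = (\<lambda>x. \<Sum>i\<le>n. a i * x ^ i)"
    by (auto simp: real_polynomial_function_iff_sum)
  have g_cont: "continuous_on UNIV g" unfolding g_eq by (intro continuous_intros)
  have mono_int: "integrable ?M (\<lambda>v. exp (- v) ^ i * h v)" if "integrable ?M h" for h i
    using integrable_comp_exp_gamma_measure[of "\<lambda>x. x ^ i", OF _ that]
    by (simp add: continuous_intros)
  have g_int: "(\<integral>v. g (exp (- v)) * h v \<partial>?M) = (\<Sum>i\<le>n. a i * (\<integral>v. exp (- v) ^ i * h v \<partial>?M))"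
    if "integrable ?M h" for h
  proof -
    have "(\<integral>v. g (exp (- v)) * h v \<partial>?M) = (\<integral>v. (\<Sum>i\<le>n. a i * (exp (- v) ^ i * h v)) \<partial>?M)"
      by (simp add: g_eq sum_distrib_right mult.assoc)
    also have "\<dots> = (\<Sum>i\<le>n. (\<integral>v. a i * (exp (- v) ^ i * h v) \<partial>?M))"
      by (rule Bochner_Integration.integral_sum) (use mono_int[OF that] in auto)
    finally show ?thesis by simp
  qed
  have err: "\<bar>(\<integral>v. f (exp (- v)) * h v \<partial>?M) - (\<integral>v. g (exp (- v)) * h v \<partial>?M)\<bar> \<le> \<eta> * (\<integral>v. \<bar>h v\<bar> \<partial>?M)"
    if "integrable ?M h" for h
  proof -
    have ints: "integrable ?M (\<lambda>v. f (exp (- v)) * h v)" "integrable ?M (\<lambda>v. g (exp (- v)) * h v)"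
      using integrable_comp_exp_gamma_measure[OF f that] integrable_comp_exp_gamma_measure[OF g_cont that] .
    have "\<bar>(\<integral>v. f (exp (- v)) * h v \<partial>?M) - (\<integral>v. g (exp (- v)) * h v \<partial>?M)\<bar>
        = \<bar>\<integral>v. f (exp (- v)) * h v - g (exp (- v)) * h v \<partial>?M\<bar>"
      using ints by simp
    also have "\<dots> \<le> (\<integral>v. \<bar>f (exp (- v)) * h v - g (exp (- v)) * h v\<bar> \<partial>?M)"
      by (rule integral_abs_bound)
    also have "\<dots> \<le> (\<integral>v. \<eta> * \<bar>h v\<bar> \<partial>?M)"
    proof (rule integral_mono)
      fix v assume "v \<in> space ?M"
      then have "\<bar>f (exp (- v)) - g (exp (- v))\<bar> \<le> \<eta>" using g(2)[of "exp (- v)"] by simp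
      then show "\<bar>f (exp (- v)) * h v - g (exp (- v)) * h v\<bar> \<le> \<eta> * \<bar>h v\<bar>"
        unfolding left_diff_distrib[symmetric] abs_mult by (rule mult_right_mono) simp
    qed (use ints that in auto)
    finally show ?thesis by simp
  qed
  have "((\<lambda>s. \<Sum>i\<le>n. a i * (\<integral>v. exp (- v) ^ i * D s v \<partial>?M))
      \<longlongrightarrow> (\<Sum>i\<le>n. a i * (\<integral>v. exp (- v) ^ i * D\<^sub>0 v \<partial>?M))) F"
    by (intro tendsto_intros lim)
  then have "\<forall>\<^sub>F s in F. \<bar>(\<Sum>i\<le>n. a i * (\<integral>v. exp (- v) ^ i * D s v \<partial>?M))
      - (\<Sum>i\<le>n. a i * (\<integral>v. exp (- v) ^ i * D\<^sub>0 v \<partial>?M))\<bar> < e / 2"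
    using \<open>e > 0\<close> by (auto dest!: tendstoD[where e = "e / 2"] simp: dist_real_def)
  with int L1 show "\<forall>\<^sub>F s in F. dist (\<integral>v. f (exp (- v)) * D s v \<partial>?M) (\<integral>v. f (exp (- v)) * D\<^sub>0 v \<partial>?M) < e"
  proof eventually_elim
    case (elim s)
    have "\<eta> * (\<integral>v. \<bar>D s v\<bar> \<partial>?M) \<le> \<eta> * \<bar>B\<bar>" using elim \<open>\<eta> > 0\<close> by (intro mult_left_mono) auto
    moreover have "\<eta> * \<bar>B\<bar> + \<eta> * B0 \<le> e / 2"
    proof -
      have "\<eta> * \<bar>B\<bar> + \<eta> * B0 \<le> \<eta> * S"
        using \<open>\<eta> > 0\<close> by (simp add: S_def distrib_left)
      also have "\<dots> = e / 2" using \<open>S > 0\<close> by (simp add: \<eta>_def)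
      finally show ?thesis .
    qed
    ultimately show ?case
      using err[OF elim(1)] err[OF D\<^sub>0] elim(3)
      unfolding g_int[OF elim(1)] g_int[OF D\<^sub>0] dist_real_def B0_def[symmetric] by linarith
  qed
qed

text \<open>By monotonicity \<open>D s v\<close> lies below averages of \<open>D s\<close> to the
  right of \<open>v\<close> and above averages to the left. Averages against bumps converge, and
  continuity of \<open>D\<^sub>0\<close> at \<open>v\<close> puts the limits for narrow bumps close
  to \<open>D\<^sub>0 v\<close>.\<close>

theorem tauberian_monotone:
  fixes D :: "real \<Rightarrow> real \<Rightarrow> real" and D\<^sub>0 :: "real \<Rightarrow> real"
  assumes "\<alpha> > -1"
    and mono: "\<forall>\<^sub>F s in F. mono_on {0<..} (D s)"
    and int: "\<forall>\<^sub>F s in F. integrable (gamma_measure \<alpha>) (D s)"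
    and D\<^sub>0: "integrable (gamma_measure \<alpha>) D\<^sub>0"
    and lim: "\<And>j::nat. ((\<lambda>s. \<integral>v. exp (- v) ^ j * D s v \<partial>gamma_measure \<alpha>)
        \<longlongrightarrow> (\<integral>v. exp (- v) ^ j * D\<^sub>0 v \<partial>gamma_measure \<alpha>)) F"
    and "v > 0" and cont: "isCont D\<^sub>0 v"
  shows "((\<lambda>s. D s v) \<longlongrightarrow> D\<^sub>0 v) F"
proof (rule tendstoI)
  let ?M = "gamma_measure \<alpha>"
  fix e :: real assume "e > 0"
  obtain K where K: "\<And>D B. mono_on {0<..} D \<Longrightarrow> integrable ?M D \<Longrightarrow>
    \<bar>\<integral>v. D v \<partial>?M\<bar> \<le> B \<Longrightarrow> \<bar>\<integral>v. exp (- v) * D v \<partial>?M\<bar> \<le> B \<Longrightarrow>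
    (\<integral>v. \<bar>D v\<bar> \<partial>?M) \<le> K * B"
    using tauberian_L1_bound[OF \<open>\<alpha> > -1\<close>] by blast
  \<comment> \<open>The summand 1 makes the inequalities strict in the limit, so the moments of
    orders 0 and 1 satisfy them eventually.\<close>
  define B where "B = \<bar>\<integral>v. D\<^sub>0 v \<partial>?M\<bar> + \<bar>\<integral>v. exp (- v) * D\<^sub>0 v \<partial>?M\<bar> + 1"
  have ev1: "\<forall>\<^sub>F s in F. \<bar>(\<integral>v. D s v \<partial>?M)\<bar> < B"
    using lim[of 0] by (intro order_tendstoD(2)[OF tendsto_rabs]) (auto simp: B_def)
  have ev2: "\<forall>\<^sub>F s in F. \<bar>(\<integral>v. exp (- v) * D s v \<partial>?M)\<bar> < B"
    using lim[of 1] by (intro order_tendstoD(2)[OF tendsto_rabs]) (auto simp: B_def)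
  from ev1 ev2 mono int have L1: "\<forall>\<^sub>F s in F. (\<integral>v. \<bar>D s v\<bar> \<partial>?M) \<le> K * B"
    by eventually_elim (rule K, auto)
  note test = tauberian_test_functions[OF int D\<^sub>0 L1 lim]
  obtain d where d: "d > 0" "\<And>w. \<bar>w - v\<bar> < d \<Longrightarrow> \<bar>D\<^sub>0 w - D\<^sub>0 v\<bar> < e / 2"
    using cont \<open>e > 0\<close> unfolding continuous_at_eps_delta dist_real_def by (meson half_gt_zero)
  have near: "D\<^sub>0 w \<le> D\<^sub>0 v + e / 2" "D\<^sub>0 v - e / 2 \<le> D\<^sub>0 w" if "\<bar>w - v\<bar> < d" for w
    using d(2)[OF that] by linarith+
  \<comment> \<open>Keeps the bump to the left of \<open>v\<close> inside the positive
    half-line.\<close>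
  define d' where "d' = min d v"
  have d': "d' > 0" "d' \<le> v" "d' \<le> d" using d \<open>v > 0\<close> by (auto simp: d'_def)
  have vb: "0 \<le> v" "v < v + d'" "0 \<le> v - d'" "v - d' < v" using d' \<open>v > 0\<close> by auto
  obtain f :: "real \<Rightarrow> real" where "continuous_on UNIV f \<and> (\<forall>x. f x \<ge> 0) \<and> (\<forall>w. w \<notin> {v<..<v + d'} \<longrightarrow> f (exp (- w)) = 0)
    \<and> (\<integral>w. f (exp (- w)) \<partial>?M) > 0"
    using gamma_measure_bump[OF \<open>\<alpha> > -1\<close> vb(1,2)] ..
  then have f: "continuous_on UNIV f" "\<And>x. f x \<ge> 0"
    "\<And>w. w \<notin> {v<..<v + d'} \<Longrightarrow> f (exp (- w)) = 0" "(\<integral>w. f (exp (- w)) \<partial>?M) > 0"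
    by auto
  obtain g :: "real \<Rightarrow> real" where "continuous_on UNIV g \<and> (\<forall>x. g x \<ge> 0) \<and> (\<forall>w. w \<notin> {v - d'<..<v} \<longrightarrow> g (exp (- w)) = 0)
    \<and> (\<integral>w. g (exp (- w)) \<partial>?M) > 0"
    using gamma_measure_bump[OF \<open>\<alpha> > -1\<close> vb(3,4)] ..
  then have g: "continuous_on UNIV g" "\<And>x. g x \<ge> 0"
    "\<And>w. w \<notin> {v - d'<..<v} \<Longrightarrow> g (exp (- w)) = 0" "(\<integral>w. g (exp (- w)) \<partial>?M) > 0"
    by auto
  interpret finite_measure ?M using assms by (intro finite_measure_gamma_measure)
  have bump_int: "integrable ?M (\<lambda>w. f (exp (- w)) * c)" "integrable ?M (\<lambda>w. g (exp (- w)) * c)" for c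
    using f(1) g(1) by (intro integrable_comp_exp_gamma_measure; simp)+
  have "(\<integral>w. f (exp (- w)) * D\<^sub>0 w \<partial>?M) \<le> (\<integral>w. f (exp (- w)) * (D\<^sub>0 v + e / 2) \<partial>?M)"
  proof (rule integral_mono[OF integrable_comp_exp_gamma_measure[OF f(1) D\<^sub>0] bump_int(1)])
    fix w show "f (exp (- w)) * D\<^sub>0 w \<le> f (exp (- w)) * (D\<^sub>0 v + e / 2)"
    proof (cases "w \<in> {v<..<v + d'}")
      case True
      then show ?thesis using near[of w] d' f(2) by (intro mult_left_mono) auto
    qed (use f(3) in simp)
  qed
  also have "\<dots> < (\<integral>w. f (exp (- w)) \<partial>?M) * (D\<^sub>0 v + e)"
    using f(4) \<open>e > 0\<close> by simp
  finally have "\<forall>\<^sub>F s in F. (\<integral>w. f (exp (- w)) * D s w \<partial>?M) < (\<integral>w. f (exp (- w)) \<partial>?M) * (D\<^sub>0 v + e)"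
    by (rule order_tendstoD(2)[OF test[OF f(1)]])
  with mono int have upper: "\<forall>\<^sub>F s in F. D s v < D\<^sub>0 v + e"
  proof eventually_elim
    case (elim s)
    have "(\<integral>w. f (exp (- w)) * D s v \<partial>?M) \<le> (\<integral>w. f (exp (- w)) * D s w \<partial>?M)"
    proof (rule integral_mono[OF bump_int(1) integrable_comp_exp_gamma_measure[OF f(1) elim(2)]])
      fix w show "f (exp (- w)) * D s v \<le> f (exp (- w)) * D s w"
      proof (cases "w \<in> {v<..<v + d'}")
        case True
        then show ?thesis using mono_onD[OF elim(1), of v w] \<open>v > 0\<close> f(2) by (intro mult_left_mono) auto
      qed (use f(3) in simp)
    qed
    then have "(\<integral>w. f (exp (- w)) \<partial>?M) * D s v < (\<integral>w. f (exp (- w)) \<partial>?M) * (D\<^sub>0 v + e)"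
      using elim(3) by simp
    then show ?case using f(4) by simp
  qed
  have "(\<integral>w. g (exp (- w)) \<partial>?M) * (D\<^sub>0 v - e) < (\<integral>w. g (exp (- w)) * (D\<^sub>0 v - e / 2) \<partial>?M)"
    using g(4) \<open>e > 0\<close> by simp
  also have "\<dots> \<le> (\<integral>w. g (exp (- w)) * D\<^sub>0 w \<partial>?M)"
  proof (rule integral_mono[OF bump_int(2) integrable_comp_exp_gamma_measure[OF g(1) D\<^sub>0]])
    fix w show "g (exp (- w)) * (D\<^sub>0 v - e / 2) \<le> g (exp (- w)) * D\<^sub>0 w"
    proof (cases "w \<in> {v - d'<..<v}")
      case True
      then show ?thesis using near[of w] d' g(2) by (intro mult_left_mono) auto
    qed (use g(3) in simp)
  qed
  finally have "\<forall>\<^sub>F s in F. (\<integral>w. g (exp (- w)) \<partial>?M) * (D\<^sub>0 v - e) < (\<integral>w. g (exp (- w)) * D s w \<partial>?M)"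
    by (rule order_tendstoD(1)[OF test[OF g(1)]])
  with mono int have lower: "\<forall>\<^sub>F s in F. D\<^sub>0 v - e < D s v"
  proof eventually_elim
    case (elim s)
    have "(\<integral>w. g (exp (- w)) * D s w \<partial>?M) \<le> (\<integral>w. g (exp (- w)) * D s v \<partial>?M)"
    proof (rule integral_mono[OF integrable_comp_exp_gamma_measure[OF g(1) elim(2)] bump_int(2)])
      fix w show "g (exp (- w)) * D s w \<le> g (exp (- w)) * D s v"
      proof (cases "w \<in> {v - d'<..<v}")
        case True
        then show ?thesis using mono_onD[OF elim(1), of w v] \<open>v > 0\<close> d' g(2) by (intro mult_left_mono) auto
      qed (use g(3) in simp)
    qed
    then have "(\<integral>w. g (exp (- w)) \<partial>?M) * (D\<^sub>0 v - e) < (\<integral>w. g (exp (- w)) \<partial>?M) * D s v"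
      using elim(3) by simp
    then show ?case using g(4) by simp
  qed
  from upper lower show "\<forall>\<^sub>F s in F. dist (D s v) (D\<^sub>0 v) < e"
    by eventually_elim (auto simp: dist_real_def)
qed

text \<open>Here the locale function \<open>L\<close> is the known transform, and \<open>G\<close>
  is the unknown under the integral. A second-order expansion of \<open>G / L\<close> is exactly
  what \<open>second_order_transfer\<close> turns into second-order behaviour of
  \<open>G\<close>.\<close>

theorem (in second_order_slow) tauberian:
  fixes G :: "real \<Rightarrow> real" and \<alpha> T :: real
  defines "c\<^sub>0 \<equiv> \<integral>u. 1 \<partial>gamma_measure \<alpha>" and "c\<^sub>1 \<equiv> \<integral>u. ln u \<partial>gamma_measure \<alpha>"
  assumes "\<alpha> > -1" and G: "G \<in> borel_measurable (lebesgue_on {0<..})"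
    and loc: "\<And>T. \<exists>M. \<forall>t. 0 < t \<and> t < T \<longrightarrow> \<bar>t powr \<alpha> * G t\<bar> \<le> M"
    and G_int: "\<And>s. s > 0 \<Longrightarrow> integrable (gamma_measure \<alpha>) (\<lambda>u. G (s * u))"
    and L_eq: "\<And>s. s > 0 \<Longrightarrow> L s = (\<integral>u. G (s * u) \<partial>gamma_measure \<alpha>)"
    and "T > 0" and mono: "monotone_on {T..} (\<le>) (\<le>) G \<or> monotone_on {T..} (\<le>) (\<ge>) G"
  shows "((\<lambda>s. (G s / L s - 1 / c\<^sub>0) / A s) \<longlongrightarrow> - c\<^sub>1 / c\<^sub>0\<^sup>2) at_top"
proof -
  let ?M = "gamma_measure \<alpha>"
  interpret finite_measure ?M using \<open>\<alpha> > -1\<close> by (intro finite_measure_gamma_measure)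
  have "c\<^sub>0 > 0" unfolding c\<^sub>0_def by (rule integral_one_gamma_measure_pos[OF \<open>\<alpha> > -1\<close>])
  \<comment> \<open>Freezing \<open>G\<close> below \<open>T\<close> makes \<open>D s\<close>
    monotone on the whole half-line, not only for large arguments.\<close>
  define D where "D s v = (c\<^sub>0 * G (max (s * v) T) / L s - 1) / A s" for s v
  define D\<^sub>0 where "D\<^sub>0 v = ln v - c\<^sub>1 / c\<^sub>0" for v
  obtain M where M: "\<And>t. 0 < t \<Longrightarrow> t < T \<Longrightarrow> \<bar>t powr \<alpha> * G t\<bar> \<le> M" using loc[of T] by blast
  define err where "err s = (\<integral>u. G (s * u) - G (max (s * u) T) \<partial>?M)" for s
  obtain C where C: "C \<ge> 0" "\<And>s. s > 0 \<Longrightarrow> integrable ?M (\<lambda>u. G (s * u) - G (max (s * u) T))"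
    "\<And>s. s > 0 \<Longrightarrow> \<bar>err s\<bar> \<le> C * s powr (- \<alpha> - 1)"
    unfolding err_def
    by (rule cutoff_error[OF G \<open>\<alpha> > -1\<close> \<open>T > 0\<close> M]) blast+
  have Gmax_int: "integrable ?M (\<lambda>u. G (max (s * u) T))" if "s > 0" for s
    using Bochner_Integration.integrable_diff[OF G_int[OF that] C(2)[OF that]] by simp
  have Gmax_integral: "(\<integral>u. G (max (s * u) T) \<partial>?M) = L s - err s" if "s > 0" for s
    using G_int[OF that] Gmax_int[OF that] by (simp add: err_def L_eq[OF that])
  have ln_int: "integrable ?M ln" using \<open>\<alpha> > -1\<close> by (rule integrable_ln_gamma_measure)
  have D\<^sub>0_int: "integrable ?M D\<^sub>0" unfolding D\<^sub>0_def using ln_int by auto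
  have D_int: "integrable ?M (D s)" if "s > 0" for s
    unfolding D_def using Gmax_int[OF that] by auto
  have exp_power: "exp (- v) ^ j = exp (- ((real j + 1) - 1) * v)" for v j
    by (simp add: exp_of_nat_mult[symmetric])
  have meas: "f \<in> borel_measurable (lebesgue_on {0<..})" if "integrable ?M f" for f
    using borel_measurable_integrable[OF that] by (simp add: borel_measurable_gamma_measure_iff)
  have D_lim: "((\<lambda>s. \<integral>v. exp (- v) ^ j * D s v \<partial>?M) \<longlongrightarrow> (\<integral>v. exp (- v) ^ j * D\<^sub>0 v \<partial>?M)) at_top" for j :: nat
  proof -
    \<comment> \<open>For this \<open>c\<close> the power \<open>exp (- v) ^ j\<close> is the factor
      \<open>exp (- (c - 1) * v)\<close> of the change of variables.\<close>
    define c where "c = real j + 1"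
    have "c > 0" by (simp add: c_def)
    have "(\<integral>v. exp (- v) ^ j * D\<^sub>0 v \<partial>?M) = c powr (- \<alpha> - 1) * (\<integral>u. D\<^sub>0 (u / c) \<partial>?M)"
      unfolding exp_power c_def[symmetric]
      by (rule integral_exp_gamma_measure[OF meas[OF D\<^sub>0_int] \<open>c > 0\<close>])
    also have "(\<integral>u. D\<^sub>0 (u / c) \<partial>?M) = (\<integral>u. ln u - (ln c + c\<^sub>1 / c\<^sub>0) \<partial>?M)"
      by (rule Bochner_Integration.integral_cong) (use \<open>c > 0\<close> in \<open>auto simp: D\<^sub>0_def ln_div\<close>)
    also have "\<dots> = c\<^sub>1 - (ln c + c\<^sub>1 / c\<^sub>0) * c\<^sub>0"
      using ln_int by (simp add: c\<^sub>1_def c\<^sub>0_def)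
    \<comment> \<open>The shift \<open>c\<^sub>1 / c\<^sub>0\<close> in \<open>D\<^sub>0\<close>
      cancels the integral of \<open>ln\<close>; what remains matches the second-order limit of
      \<open>L\<close> at the factor \<open>1 / c\<close>.\<close>
    also have "\<dots> = c\<^sub>0 * ln (1 / c)"
      using \<open>c\<^sub>0 > 0\<close> \<open>c > 0\<close> by (simp add: ln_div field_simps)
    finally have rhs: "(\<integral>v. exp (- v) ^ j * D\<^sub>0 v \<partial>?M) = c powr (- \<alpha> - 1) * (c\<^sub>0 * ln (1 / c))" .
    have lhs: "(\<integral>v. exp (- v) ^ j * D s v \<partial>?M) =
        c powr (- \<alpha> - 1) * (c\<^sub>0 * ((L (s * (1 / c)) / L s - 1) / A s - err (s / c) / L s / A s))" if "s > 0" for s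
    proof -
      have "s / c > 0" using \<open>c > 0\<close> that by simp
      have "(\<integral>v. exp (- v) ^ j * D s v \<partial>?M) = c powr (- \<alpha> - 1) * (\<integral>u. D s (u / c) \<partial>?M)"
        unfolding exp_power c_def[symmetric]
        by (rule integral_exp_gamma_measure[OF meas[OF D_int[OF that]] \<open>c > 0\<close>])
      also have "(\<integral>u. D s (u / c) \<partial>?M) = (\<integral>u. (c\<^sub>0 * G (max (s / c * u) T) / L s - 1) / A s \<partial>?M)"
        unfolding D_def by (simp add: field_simps)
      also have "\<dots> = (c\<^sub>0 * (L (s / c) - err (s / c)) / L s - c\<^sub>0) / A s"
        using Gmax_int[OF \<open>s / c > 0\<close>] Gmax_integral[OF \<open>s / c > 0\<close>] by (simp add: c\<^sub>0_def)
      also have "\<dots> = c\<^sub>0 * ((L (s * (1 / c)) / L s - 1) / A s - err (s / c) / L s / A s)"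
        by (simp add: diff_divide_distrib right_diff_distrib)
      finally show ?thesis .
    qed
    have "((\<lambda>s. err (s / c) / L s / A s) \<longlongrightarrow> 0) at_top"
    proof (rule cutoff_error_negligible[where C = "C * c powr (\<alpha> + 1)" and \<alpha> = \<alpha>])
      fix s :: real assume "s > 0"
      then have "\<bar>err (s / c)\<bar> \<le> C * (s / c) powr (- \<alpha> - 1)" using C(3) \<open>c > 0\<close> by simp
      also have "(s / c) powr (- \<alpha> - 1) = s powr (- \<alpha> - 1) / c powr (- (\<alpha> + 1))"
        using \<open>s > 0\<close> \<open>c > 0\<close> by (simp add: powr_divide)
      also have "\<dots> = c powr (\<alpha> + 1) * s powr (- \<alpha> - 1)"
        by (subst powr_minus) (simp add: field_simps)
      finally show "\<bar>err (s / c)\<bar> \<le> C * c powr (\<alpha> + 1) * s powr (- \<alpha> - 1)" by (simp add: mult.assoc)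
    qed fact
    then have "((\<lambda>s. c powr (- \<alpha> - 1) * (c\<^sub>0 * ((L (s * (1 / c)) / L s - 1) / A s - err (s / c) / L s / A s)))
        \<longlongrightarrow> c powr (- \<alpha> - 1) * (c\<^sub>0 * (ln (1 / c) - 0))) at_top"
      using \<open>c > 0\<close> by (intro tendsto_intros L_second_order) auto
    moreover have "\<forall>\<^sub>F s in at_top. c powr (- \<alpha> - 1) * (c\<^sub>0 * ((L (s * (1 / c)) / L s - 1) / A s - err (s / c) / L s / A s))
        = (\<integral>v. exp (- v) ^ j * D s v \<partial>?M)"
      using eventually_gt_at_top[of 0] by eventually_elim (simp only: lhs)
    ultimately show ?thesis unfolding rhs diff_0_right by (rule Lim_transform_eventually)
  qed
  \<comment> \<open>\<open>\<kappa>\<close> is the eventual sign of \<open>A\<close>, and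
    \<open>\<tau>\<close> below encodes the direction in which \<open>G\<close> is monotone. Their
    product \<open>\<sigma>\<close> makes \<open>\<sigma> * D s\<close> increasing, and a second
    multiplication by \<open>\<sigma>\<close> removes it.\<close>
  obtain \<kappa> where \<kappa>: "\<kappa> = 1 \<or> \<kappa> = -1" "\<forall>\<^sub>F s in at_top. \<kappa> / A s > 0"
  proof -
    consider "\<forall>\<^sub>F s in at_top. A s > 0" | "\<forall>\<^sub>F s in at_top. A s < 0"
      using A_sign unfolding eventually_const_sign_def by blast
    then show ?thesis
    proof cases
      case 1
      then have "\<forall>\<^sub>F s in at_top. 1 / A s > 0" by eventually_elim simp
      then show ?thesis by (intro that[of 1]) auto
    next
      case 2
      then have "\<forall>\<^sub>F s in at_top. -1 / A s > 0" by eventually_elim (simp add: divide_neg_neg)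
      then show ?thesis by (intro that[of "-1"]) auto
    qed
  qed
  obtain \<tau> where \<tau>: "\<tau> = 1 \<or> \<tau> = -1" "\<And>x y. T \<le> x \<Longrightarrow> x \<le> y \<Longrightarrow> \<tau> * G x \<le> \<tau> * G y"
  proof -
    from mono show ?thesis
    proof
      assume "monotone_on {T..} (\<le>) (\<le>) G"
      then show ?thesis by (intro that[of 1]) (auto simp: monotone_on_def)
    next
      assume "monotone_on {T..} (\<le>) (\<ge>) G"
      then show ?thesis by (intro that[of "-1"]) (auto simp: monotone_on_def)
    qed
  qed
  define \<sigma> where "\<sigma> = \<tau> * \<kappa>"
  have \<sigma>: "\<sigma> * (\<sigma> * x) = x" for x using \<kappa>(1) \<tau>(1) by (auto simp: \<sigma>_def)
  have lim1: "((\<lambda>s. \<sigma> * D s 1) \<longlongrightarrow> \<sigma> * D\<^sub>0 1) at_top"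
  proof (rule tauberian_monotone[where D = "\<lambda>s v. \<sigma> * D s v" and D\<^sub>0 = "\<lambda>v. \<sigma> * D\<^sub>0 v", OF \<open>\<alpha> > -1\<close>])
    show "\<forall>\<^sub>F s in at_top. mono_on {0<..} (\<lambda>v. \<sigma> * D s v)"
      using \<kappa>(2) L_pos eventually_gt_at_top[of 0]
    proof eventually_elim
      case (elim s)
      show ?case
      proof (rule mono_onI)
        fix v w :: real assume vw: "v \<in> {0<..}" "w \<in> {0<..}" "v \<le> w"
        then have "max (s * v) T \<le> max (s * w) T"
          using elim(3) by (intro max.mono mult_left_mono) auto
        then have "\<tau> * G (max (s * v) T) \<le> \<tau> * G (max (s * w) T)" by (intro \<tau>(2)) auto
        then have "0 \<le> (c\<^sub>0 / L s) * (\<kappa> / A s) * (\<tau> * G (max (s * w) T) - \<tau> * G (max (s * v) T))"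
          using elim \<open>c\<^sub>0 > 0\<close> by (intro mult_nonneg_nonneg) auto
        also have "\<dots> = \<sigma> * D s w - \<sigma> * D s v"
          by (simp add: \<sigma>_def D_def diff_divide_distrib right_diff_distrib mult_ac)
        finally show "\<sigma> * D s v \<le> \<sigma> * D s w" by simp
      qed
    qed
    show "\<forall>\<^sub>F s in at_top. integrable ?M (\<lambda>v. \<sigma> * D s v)"
      using eventually_gt_at_top[of 0] by eventually_elim (use D_int in auto)
    show "((\<lambda>s. \<integral>v. exp (- v) ^ j * (\<sigma> * D s v) \<partial>?M) \<longlongrightarrow> (\<integral>v. exp (- v) ^ j * (\<sigma> * D\<^sub>0 v) \<partial>?M)) at_top" for j :: nat
      using tendsto_mult[OF tendsto_const[of \<sigma>] D_lim[of j]] by (simp add: mult.left_commute)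
    show "isCont (\<lambda>v. \<sigma> * D\<^sub>0 v) 1" unfolding D\<^sub>0_def by (intro continuous_intros) auto
  qed (use D\<^sub>0_int in auto)
  \<comment> \<open>At \<open>v = 1\<close> the logarithm vanishes and \<open>max s T = s\<close>
    for large \<open>s\<close>, so the limit of \<open>D s 1\<close> is already the claim up to the
    factor \<open>c\<^sub>0\<close>.\<close>
  have "((\<lambda>s. \<sigma> * (\<sigma> * D s 1) / c\<^sub>0) \<longlongrightarrow> \<sigma> * (\<sigma> * D\<^sub>0 1) / c\<^sub>0) at_top"
    by (intro tendsto_divide tendsto_mult[OF tendsto_const lim1] tendsto_const) (use \<open>c\<^sub>0 > 0\<close> in simp)
  then have "((\<lambda>s. D s 1 / c\<^sub>0) \<longlongrightarrow> - c\<^sub>1 / c\<^sub>0\<^sup>2) at_top"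
    unfolding \<sigma> by (simp add: D\<^sub>0_def power2_eq_square)
  moreover have "\<forall>\<^sub>F s in at_top. D s 1 / c\<^sub>0 = (G s / L s - 1 / c\<^sub>0) / A s"
    using eventually_ge_at_top[of T]
    by eventually_elim (use \<open>c\<^sub>0 > 0\<close> in \<open>simp add: D_def max_def diff_divide_distrib\<close>)
  ultimately show ?thesis by (rule Lim_transform_eventually)
qed

section \<open>Transfer to the Laplace--Stieltjes transform\<close>

lemma borel_measurable_powr_times_lebesgue_on:
  fixes f :: "real \<Rightarrow> real"
  assumes "f \<in> borel_measurable (lebesgue_on S)"
  shows "(\<lambda>t. t powr p * f t) \<in> borel_measurable (lebesgue_on S)"
  by (rule borel_measurable_times[OF borel_imp_lebesgue_on assms]) simp

lemma null_slowly_varying_A_inf_0: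
  assumes "A \<in> A_inf_0"
  shows "null_slowly_varying A"
proof
  show "((\<lambda>t. A (t * x) / A t) \<longlongrightarrow> 1) at_top" if "x > 0" for x
    using assms that unfolding A_inf_0_def RV_inf_def by fastforce
qed (use assms in \<open>auto simp: A_inf_0_def RV_inf_def\<close>)

lemma second_order_slow_twoRV:
  assumes "A \<in> A_inf_0" "F \<in> twoRV_inf_0 \<alpha> A" "\<forall>\<^sub>F t in at_top. F t > 0"
  shows "second_order_slow A (\<lambda>t. t powr (- \<alpha>) * F t)"
proof -
  interpret null_slowly_varying A using assms(1) by (rule null_slowly_varying_A_inf_0)
  show ?thesis
  proof
    have "F \<in> borel_measurable (lebesgue_on {0<..})"
      using assms(2) by (auto simp: twoRV_inf_0_def RV_inf_def)
    then show "(\<lambda>t. t powr (- \<alpha>) * F t) \<in> borel_measurable (lebesgue_on {0<..})"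
      by (rule borel_measurable_powr_times_lebesgue_on)
    show "\<forall>\<^sub>F t in at_top. 0 < t powr (- \<alpha>) * F t"
      using assms(3) eventually_gt_at_top[of 0] by eventually_elim simp
    fix x :: real assume "x > 0"
    have lim: "((\<lambda>t. x powr (- \<alpha>) * ((F (t * x) / F t - x powr \<alpha>) / A t)) \<longlongrightarrow> x powr (- \<alpha>) * (x powr \<alpha> * ln x)) at_top"
      using assms(2) \<open>x > 0\<close> unfolding twoRV_inf_0_def by (intro tendsto_intros) auto
    have eq: "\<forall>\<^sub>F t in at_top. x powr (- \<alpha>) * ((F (t * x) / F t - x powr \<alpha>) / A t)
        = ((t * x) powr (- \<alpha>) * F (t * x) / (t powr (- \<alpha>) * F t) - 1) / A t"
      using eventually_gt_at_top[of 0]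
    proof eventually_elim
      case (elim t)
      then have "(t * x) powr (- \<alpha>) * F (t * x) / (t powr (- \<alpha>) * F t) = x powr (- \<alpha>) * (F (t * x) / F t)"
        using \<open>x > 0\<close> by (simp add: powr_mult)
      then show ?case using \<open>x > 0\<close> by (simp add: right_diff_distrib powr_add[symmetric])
    qed
    have "x powr (- \<alpha>) * (x powr \<alpha> * ln x) = ln x"
      using \<open>x > 0\<close> by (simp add: mult.assoc[symmetric] powr_add[symmetric])
    with Lim_transform_eventually[OF lim eq]
    show "((\<lambda>t. ((t * x) powr (- \<alpha>) * F (t * x) / (t powr (- \<alpha>) * F t) - 1) / A t) \<longlongrightarrow> ln x) at_top"
      by (simp only:)
  qed
qed

lemma twoRV_second_order_slow:
  assumes "second_order_slow A (\<lambda>t. t powr (- \<alpha>) * F t)"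
  shows "F \<in> twoRV_inf_0 \<alpha> A"
proof -
  define L where "L t = t powr (- \<alpha>) * F t" for t
  interpret second_order_slow A L unfolding L_def by (rule assms)
  have F: "F t = t powr \<alpha> * L t" if "t > 0" for t
    using that by (simp add: L_def mult.assoc[symmetric] powr_add[symmetric])
  have ratio: "F (t * x) / F t = x powr \<alpha> * (L (t * x) / L t)" if "x > 0" "t > 0" for t x
    using that by (simp add: F powr_mult)
  have "(\<lambda>t. t powr \<alpha> * L t) \<in> borel_measurable (lebesgue_on {0<..})"
    using L_measurable by (rule borel_measurable_powr_times_lebesgue_on)
  then have meas: "F \<in> borel_measurable (lebesgue_on {0<..})"
    by (rule measurable_cong[THEN iffD1, rotated]) (simp add: F)
  have "\<forall>\<^sub>F t in at_top. F t > 0"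
    using L_pos eventually_gt_at_top[of 0] by eventually_elim (simp add: F)
  then have sign: "eventually_const_sign F" by (simp add: eventually_const_sign_def)
  have first: "((\<lambda>t. F (t * x) / F t) \<longlongrightarrow> x powr \<alpha>) at_top" if "x > 0" for x
  proof -
    have "((\<lambda>t. x powr \<alpha> * (L (t * x) / L t)) \<longlongrightarrow> x powr \<alpha> * 1) at_top"
      by (intro tendsto_intros L_ratio that)
    moreover have "\<forall>\<^sub>F t in at_top. x powr \<alpha> * (L (t * x) / L t) = F (t * x) / F t"
      using eventually_gt_at_top[of 0] by eventually_elim (simp only: ratio[OF that])
    ultimately show ?thesis by (simp add: Lim_transform_eventually)
  qed
  have second: "((\<lambda>t. (F (t * x) / F t - x powr \<alpha>) / A t) \<longlongrightarrow> x powr \<alpha> * ln x) at_top" if "x > 0" for x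
  proof -
    have "((\<lambda>t. x powr \<alpha> * ((L (t * x) / L t - 1) / A t)) \<longlongrightarrow> x powr \<alpha> * ln x) at_top"
      by (intro tendsto_intros L_second_order that)
    moreover have "\<forall>\<^sub>F t in at_top. x powr \<alpha> * ((L (t * x) / L t - 1) / A t) = (F (t * x) / F t - x powr \<alpha>) / A t"
      using eventually_gt_at_top[of 0] by eventually_elim (simp add: ratio[OF that] right_diff_distrib)
    ultimately show ?thesis by (rule Lim_transform_eventually)
  qed
  show ?thesis
    using meas sign first second A_sign by (simp add: twoRV_inf_0_def RV_inf_def)
qed

text \<open>Serves the measurability of the transform in its parameter: up to powers of
  \<open>s\<close> it is an increasing function.\<close>

lemma borel_measurable_lebesgue_on_mono_on:
  fixes f :: "real \<Rightarrow> real"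
  assumes "mono_on S f"
  shows "f \<in> borel_measurable (lebesgue_on S)"
proof (rule borel_measurable_subalgebra[OF _ _ borel_measurable_mono_on_fnc[OF assms]])
  show "sets (restrict_space borel S) \<subseteq> sets (lebesgue_on S)"
    using sets_completionI_sets[of _ lborel] by (intro mono_restrict_space) auto
qed (simp add: space_restrict_space)

theorem theorem4p4:
  fixes F A :: "real \<Rightarrow> real" and \<alpha> :: real
  assumes "F \<in> borel_measurable (lebesgue_on {0..})"
    and "\<And>t. t \<ge> 0 \<Longrightarrow> F t > 0"
    and "locally_bounded_on {0..} F"
    and "\<alpha> > -1"
    and "A \<in> A_inf_0"
  shows "(F \<in> twoRV_inf_0 \<alpha> A \<longrightarrow>
            (\<lambda>s. LS_transform F (1 / s)) \<in> twoRV_inf_0 \<alpha> A) \<and>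
         ((\<lambda>s. LS_transform F (1 / s)) \<in> twoRV_inf_0 \<alpha> A \<and> F \<in> M_inf_0 \<alpha> \<longrightarrow>
            F \<in> twoRV_inf_0 \<alpha> A)"
proof -
  interpret A: null_slowly_varying A using assms(5) by (rule null_slowly_varying_A_inf_0)
  let ?M = "gamma_measure \<alpha>"
  define L where "L t = t powr (- \<alpha>) * F t" for t
  define H where "H s = s powr (- \<alpha>) * LS_transform F (1 / s)" for s
  \<comment> \<open>The integrand in the original variable. It grows with \<open>s\<close> because
    \<open>F\<close> is positive; hence integrability at large \<open>s\<close> passes to every
    smaller \<open>s > 0\<close>, and the integral is monotone in \<open>s\<close>.\<close>
  define \<Phi> where "\<Phi> = (\<lambda>s t. indicator {0<..} t * (exp (- t / s) * F t))"
  have F_eq: "F t = t powr \<alpha> * L t" if "t > 0" for t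
    using that by (simp add: L_def mult.assoc[symmetric] powr_add[symmetric])
  have F_pos: "\<forall>\<^sub>F t in at_top. F t > 0"
    using eventually_ge_at_top[of 0] by eventually_elim (rule assms(2))
  have F_meas: "F \<in> borel_measurable (lebesgue_on {0<..})"
    using assms(1) by (rule measurable_restrict_mono) auto
  then have L_meas: "L \<in> borel_measurable (lebesgue_on {0<..})"
    unfolding L_def by (rule borel_measurable_powr_times_lebesgue_on)
  have loc: "\<exists>M. \<forall>t. 0 < t \<and> t < T \<longrightarrow> \<bar>t powr \<alpha> * L t\<bar> \<le> M" for T
  proof -
    have "bounded (F ` {0..T})"
      using assms(3) unfolding locally_bounded_on_def by auto
    then obtain M where "\<forall>t\<in>{0..T}. \<bar>F t\<bar> \<le> M" by (auto simp: bounded_iff)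
    then show ?thesis by (intro exI[of _ M]) (auto simp: F_eq[symmetric])
  qed
  have H_eq: "H s = (\<integral>u. L (s * u) \<partial>?M)" if "s > 0" for s
    using LS_transform_gamma_measure[of L s F \<alpha>, OF L_meas that F_eq] that
    by (simp add: H_def mult.assoc[symmetric] powr_add[symmetric])
  have L_int_iff: "integrable ?M (\<lambda>u. L (s * u)) \<longleftrightarrow> integrable lebesgue (\<Phi> s)" if "s > 0" for s
    unfolding \<Phi>_def by (rule integrable_LS_gamma_measure[OF L_meas that F_eq])
  have \<Phi>_mono: "0 \<le> \<Phi> s t \<and> \<Phi> s t \<le> \<Phi> s' t" if "0 < s" "s \<le> s'" for s s' t
  proof -
    have "exp (- t / s) * F t \<le> exp (- t / s') * F t" if "t > 0"
      using that \<open>0 < s\<close> \<open>s \<le> s'\<close> assms(2)[of t] by (intro mult_right_mono) (auto intro!: divide_left_mono)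
    then show ?thesis using assms(2)[of t] by (auto simp: \<Phi>_def indicator_def)
  qed
  have \<Phi>_meas: "\<Phi> s \<in> borel_measurable lebesgue" for s
  proof -
    have "(\<lambda>t. exp (- t / s) * F t) \<in> borel_measurable (lebesgue_on {0<..})"
      by (intro borel_measurable_times F_meas borel_imp_lebesgue_on) measurable
    then show ?thesis unfolding \<Phi>_def
      by (subst (asm) borel_measurable_restrict_space_iff) auto
  qed
  have L_int: "integrable ?M (\<lambda>u. L (s * u))"
    if ev: "\<forall>\<^sub>F s in at_top. integrable ?M (\<lambda>u. L (s * u))" and "s > 0" for s
  proof -
    have "\<forall>\<^sub>F s' in at_top. integrable ?M (\<lambda>u. L (s' * u)) \<and> s' \<ge> s"
      using ev eventually_ge_at_top[of s] by eventually_elim auto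
    then obtain s' where s': "integrable ?M (\<lambda>u. L (s' * u))" "s' \<ge> s"
      by (auto simp: eventually_at_top_linorder)
    then have "integrable lebesgue (\<Phi> s')" using L_int_iff \<open>s > 0\<close> by simp
    then have "integrable lebesgue (\<Phi> s)"
    proof (rule Bochner_Integration.integrable_bound[OF _ \<Phi>_meas], intro AE_I2)
      show "norm (\<Phi> s t) \<le> norm (\<Phi> s' t)" for t
        using \<Phi>_mono[OF \<open>s > 0\<close> s'(2), of t] by simp
    qed
    then show ?thesis using L_int_iff \<open>s > 0\<close> by simp
  qed
  have part1: "(\<lambda>s. LS_transform F (1 / s)) \<in> twoRV_inf_0 \<alpha> A" if "F \<in> twoRV_inf_0 \<alpha> A"
  proof (rule twoRV_second_order_slow)
    interpret L: second_order_slow A L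
      unfolding L_def by (rule second_order_slow_twoRV[OF assms(5) that F_pos])
    note ab = L.abelian[OF \<open>\<alpha> > -1\<close> loc]
    have lim: "((\<lambda>s. (H s / L s - (\<integral>u. 1 \<partial>?M)) / A s) \<longlongrightarrow> (\<integral>u. ln u \<partial>?M)) at_top"
    proof (rule Lim_transform_eventually[OF ab(2)])
      show "\<forall>\<^sub>F s in at_top. ((\<integral>u. L (s * u) \<partial>?M) / L s - (\<integral>u. 1 \<partial>?M)) / A s = (H s / L s - (\<integral>u. 1 \<partial>?M)) / A s"
        using eventually_gt_at_top[of 0] by eventually_elim (simp only: H_eq)
    qed
    have c\<^sub>0: "(\<integral>u. 1 \<partial>?M) > (0::real)" by (rule integral_one_gamma_measure_pos[OF \<open>\<alpha> > -1\<close>])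
    have "second_order_slow A H"
    proof
      have "mono_on {0<..} (\<lambda>s. integral\<^sup>L lebesgue (\<Phi> s))"
        using L_int[OF ab(1)] L_int_iff \<Phi>_mono by (intro mono_onI integral_mono) auto
      then have "(\<lambda>s. integral\<^sup>L lebesgue (\<Phi> s)) \<in> borel_measurable (lebesgue_on {0<..})"
        by (rule borel_measurable_lebesgue_on_mono_on)
      then have "(\<lambda>s. s powr (- \<alpha>) * (s powr -1 * integral\<^sup>L lebesgue (\<Phi> s))) \<in> borel_measurable (lebesgue_on {0<..})"
        by (intro borel_measurable_powr_times_lebesgue_on)
      then show "H \<in> borel_measurable (lebesgue_on {0<..})"
      proof (rule measurable_cong[THEN iffD1, rotated])
        fix s assume "s \<in> space (lebesgue_on {0::real<..})"
        then have "s > 0" by simp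
        then show "s powr (- \<alpha>) * (s powr -1 * integral\<^sup>L lebesgue (\<Phi> s)) = H s"
          using LS_transform_eq_lebesgue_integral[OF L_meas _ F_eq]
          by (simp add: H_def \<Phi>_def powr_minus_divide)
      qed
      show "\<forall>\<^sub>F t in at_top. 0 < H t"
        by (rule L.second_order_transfer(2)[OF c\<^sub>0 lim zero_less_one])
      show "((\<lambda>t. (H (t * x) / H t - 1) / A t) \<longlongrightarrow> ln x) at_top" if "x > 0" for x
        by (rule L.second_order_transfer(1)[OF c\<^sub>0 lim that])
    qed
    then show "second_order_slow A (\<lambda>s. s powr (- \<alpha>) * LS_transform F (1 / s))"
      unfolding H_def .
  qed
  have part2: "F \<in> twoRV_inf_0 \<alpha> A"
    if LS: "(\<lambda>s. LS_transform F (1 / s)) \<in> twoRV_inf_0 \<alpha> A" and "F \<in> M_inf_0 \<alpha>"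
  proof (rule twoRV_second_order_slow)
    have LS_nonneg: "LS_transform F (1 / s) \<ge> 0" if "s > 0" for s
      using LS_transform_eq_lebesgue_integral[OF L_meas that F_eq] that \<Phi>_mono[of s s]
      by (auto simp: \<Phi>_def intro!: mult_nonneg_nonneg Bochner_Integration.integral_nonneg)
    \<comment> \<open>Regular variation allows either sign. The integrand is nonnegative and a
      divergent integral has value 0, so only the positive sign remains.\<close>
    have LS_pos: "\<forall>\<^sub>F s in at_top. LS_transform F (1 / s) > 0"
    proof -
      have "\<not> (\<forall>\<^sub>F s in at_top. LS_transform F (1 / s) < 0)"
      proof
        assume "\<forall>\<^sub>F s in at_top. LS_transform F (1 / s) < 0"
        then have "\<forall>\<^sub>F s in at_top :: real filter. False"
          using eventually_gt_at_top[of 0] by eventually_elim (use LS_nonneg in force)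
        then show False by simp
      qed
      then show ?thesis using LS unfolding twoRV_inf_0_def RV_inf_def eventually_const_sign_def by blast
    qed
    interpret H: second_order_slow A H
      unfolding H_def by (rule second_order_slow_twoRV[OF assms(5) LS LS_pos])
    \<comment> \<open>A divergent integral would have the default value 0, contradicting that
      \<open>H\<close> is eventually positive.\<close>
    have "\<forall>\<^sub>F s in at_top. integrable ?M (\<lambda>u. L (s * u))"
      using H.L_pos eventually_gt_at_top[of 0]
      by eventually_elim (use H_eq not_integrable_integral_eq in fastforce)
    note int = L_int[OF this]
    obtain T0 where T0: "monotone_on {T0..} (\<le>) (\<le>) L \<or> monotone_on {T0..} (\<le>) (\<ge>) L"
      using \<open>F \<in> M_inf_0 \<alpha>\<close> unfolding M_inf_0_def eventually_monotone_def L_def by blast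
    \<comment> \<open>The cutoff needs a positive threshold, hence \<open>max T0 1\<close>.\<close>
    have mono: "monotone_on {max T0 1..} (\<le>) (\<le>) L \<or> monotone_on {max T0 1..} (\<le>) (\<ge>) L"
      using T0 by (auto intro: monotone_on_subset)
    have lim: "((\<lambda>s. (L s / H s - 1 / (\<integral>u. 1 \<partial>?M)) / A s) \<longlongrightarrow> - (\<integral>u. ln u \<partial>?M) / (\<integral>u. 1 \<partial>?M)\<^sup>2) at_top"
      by (rule H.tauberian[OF \<open>\<alpha> > -1\<close> L_meas loc int H_eq _ mono]) auto
    \<comment> \<open>The comparison constant is the reciprocal of the mass, since the quotient is
      now \<open>L / H\<close> instead of \<open>H / L\<close>.\<close>
    have c\<^sub>0: "1 / (\<integral>u. 1 \<partial>?M) > (0::real)" using integral_one_gamma_measure_pos[OF \<open>\<alpha> > -1\<close>] by simp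
    have "second_order_slow A L"
    proof
      show "\<forall>\<^sub>F t in at_top. 0 < L t"
        by (rule H.second_order_transfer(2)[OF c\<^sub>0 lim zero_less_one])
      show "((\<lambda>t. (L (t * x) / L t - 1) / A t) \<longlongrightarrow> ln x) at_top" if "x > 0" for x
        by (rule H.second_order_transfer(1)[OF c\<^sub>0 lim that])
    qed (rule L_meas)
    then show "second_order_slow A (\<lambda>t. t powr (- \<alpha>) * F t)" unfolding L_def .
  qed
  from part1 part2 show ?thesis by blast
qed

end
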